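(* Let $(A,\rho,t_{\mathsf d},t_{\mathsf u})$ be an oriented quantum algebra over the field $k$, let $\mathcal A=A\oplus A^{op}$ be the direct product of the algebras $A$ and $A^{op}$, and write $\rho=\sum_{\imath=1}^r a_\imath\otimes b_\imath$, $\rho^{-1}=\sum_{\jmath=1}^s\alpha_\jmath\otimes\beta_\jmath$. Then: (a) $(\mathcal A,\boldsymbol\rho,\boldsymbol s)$ is a quantum algebra over $k$, where $$\boldsymbol\rho=\sum_{\imath=1}^r\bigl(a_\imath\otimes b_\imath+\overline{a_\imath}\otimes\overline{b_\imath}\bigr)+\sum_{\jmath=1}^s\bigl(\overline{\alpha_\jmath}\otimes\beta_\jmath+\alpha_\jmath\otimes\overline{t_{\mathsf d}^{-1}\circ t_{\mathsf u}^{-1}(\beta_\jmath)}\bigr)$$ and $\boldsymbol s(a\oplus b)=b\oplus t_{\mathsf d}^{-1}\circ t_{\mathsf u}^{-1}(a)$ for all $a,b\in A$. (b) $(\mathcal A,\boldsymbol\rho,\boldsymbol t_{\mathsf d},\boldsymbol t_{\mathsf u})$ is an oriented quantum algebra over $k$, $\boldsymbol t_{\mathsf d}$ and $\boldsymbol t_{\mathsf u}$ commute with $\boldsymbol s$, and $\boldsymbol t_{\mathsf d}\circ\boldsymbol t_{\mathsf u}=\boldsymbol s^{-2}$, where $\boldsymbol t_{\mathsf d}(a\oplus b)=t_{\mathsf d}(a)\oplus t_{\mathsf d}(b)$ and $\boldsymbol t_{\mathsf u}(a\oplus b)=t_{\mathsf u}(a)\oplus t_{\mathsf u}(b)$ for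 all $a,b\in A$. (c) The projection $\pi:\mathcal A\to A$ onto the first factor determines a morphism $\pi:(\mathcal A,\boldsymbol\rho,\boldsymbol t_{\mathsf d},\boldsymbol t_{\mathsf u})\to(A,\rho,t_{\mathsf d},t_{\mathsf u})$ of oriented quantum algebras.
   Context: $k$ is a field; algebras are associative unital $k$-algebras; $\otimes=\otimes_k$; $A^{op}$ is the opposite algebra of $A$. For an algebra $A$ and $\rho=\sum_\imath a_\imath\otimes b_\imath\in A\otimes A$ put $\rho_{1\,2}=\sum_\imath a_\imath\otimes b_\imath\otimes1$, $\rho_{1\,3}=\sum_\imath a_\imath\otimes1\otimes b_\imath$, $\rho_{2\,3}=\sum_\imath1\otimes a_\imath\otimes b_\imath$. A quantum algebra over $k$ is a triple $(A,\rho,s)$ where $A$ is an algebra over $k$, $\rho\in A\otimes A$ is invertible and $s:A\to A^{op}$ is an algebra isomorphism such that $\rho^{-1}=(s\otimes1_A)(\rho)$, $\rho=(s\otimes s)(\rho)$ and $\rho_{1\,2}\rho_{1\,3}\rho_{2\,3}=\rho_{2\,3}\rho_{1\,3}\rho_{1\,2}$. An oriented quantum algebra over $k$ is a quadruple $(A,\rho,t_{\mathsf d},t_{\mathsf u})$ where $A$ is an algebra over $k$, $\rho\in A\otimes A$ is invertible and $t_{\mathsf d},t_{\mathsf u}$ are commuting algebra automorphisms of $A$ such that $(t_{\mathsf d}\otimes1_A)(\rho^{-1})$ and $(1_A\otimes t_{\mathsf u})(\rho)$ are inverses in $A\otimes A^{op}$, $\rho=(t_{\mathsf d}\otimes t_{\mathsf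 d})(\rho)=(t_{\mathsf u}\otimes t_{\mathsf u})(\rho)$, and $\rho_{1\,2}\rho_{1\,3}\rho_{2\,3}=\rho_{2\,3}\rho_{1\,3}\rho_{1\,2}$. A morphism of oriented quantum algebras $f:(A,\rho,t_{\mathsf d},t_{\mathsf u})\to(A',\rho',t'_{\mathsf d},t'_{\mathsf u})$ is an algebra map $f:A\to A'$ with $\rho'=(f\otimes f)(\rho)$, $t'_{\mathsf d}\circ f=f\circ t_{\mathsf d}$ and $t'_{\mathsf u}\circ f=f\circ t_{\mathsf u}$. In $\mathcal A=A\oplus A^{op}$ an element $a\in A$ is identified with $a\oplus0$, and $\overline{a\oplus b}=b\oplus a$ for $a,b\in A$; thus $\overline a=0\oplus a$ for $a\in A$. *)

theory Defs
  imports "HOL-Algebra.Algebra"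
begin

section \<open>Associative unital algebras over a field\<close>

text \<open>
  The library locale \<^locale>\<open>algebra\<close> is restricted to commutative algebras, so the
  noncommutative notion is introduced here.  The zero algebra is not excluded.
\<close>

locale k_algebra = K?: field K + A?: ring A + module K A
  for K :: "('k, 'm) ring_scheme" (structure) and A :: "('k, 'a, 'n) module_scheme" (structure) +
  assumes smult_mult_left:
      "\<lbrakk>c \<in> carrier K; x \<in> carrier A; y \<in> carrier A\<rbrakk> \<Longrightarrow>
        (c \<odot>\<^bsub>A\<^esub> x) \<otimes>\<^bsub>A\<^esub> y = c \<odot>\<^bsub>A\<^esub> (x \<otimes>\<^bsub>A\<^esub> y)"
    and smult_mult_right:
      "\<lbrakk>c \<in> carrier K; x \<in> carrier A; y \<in> carrier A\<rbrakk> \<Longrightarrow>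
        x \<otimes>\<^bsub>A\<^esub> (c \<odot>\<^bsub>A\<^esub> y) = c \<odot>\<^bsub>A\<^esub> (x \<otimes>\<^bsub>A\<^esub> y)"

definition alg_hom ::
  "('k, 'm) ring_scheme \<Rightarrow> ('k, 'a, 'n) module_scheme \<Rightarrow> ('k, 'b, 'p) module_scheme \<Rightarrow> ('a \<Rightarrow> 'b) set"
  where "alg_hom K A B =
    {h \<in> ring_hom A B. \<forall>c \<in> carrier K. \<forall>x \<in> carrier A. h (c \<odot>\<^bsub>A\<^esub> x) = c \<odot>\<^bsub>B\<^esub> h x}"

definition alg_iso ::
  "('k, 'm) ring_scheme \<Rightarrow> ('k, 'a, 'n) module_scheme \<Rightarrow> ('k, 'b, 'p) module_scheme \<Rightarrow> ('a \<Rightarrow> 'b) set"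
  where "alg_iso K A B = {h \<in> alg_hom K A B. bij_betw h (carrier A) (carrier B)}"

definition opposite :: "('k, 'a, 'n) module_scheme \<Rightarrow> ('k, 'a, 'n) module_scheme"
  where "opposite A = A\<lparr>monoid.mult := (\<lambda>x y. y \<otimes>\<^bsub>A\<^esub> x)\<rparr>"

definition alg_prod ::
  "('k, 'a, 'n) module_scheme \<Rightarrow> ('k, 'b, 'p) module_scheme \<Rightarrow> ('k, 'a \<times> 'b) module"
  where "alg_prod A B =
    ring.extend (RDirProd A B) \<lparr>smult = (\<lambda>c (x, y). (c \<odot>\<^bsub>A\<^esub> x, c \<odot>\<^bsub>B\<^esub> y))\<rparr>"


section \<open>Tensor products over a field\<close>

text \<open>
  The tensor product of \<open>V\<close> and \<open>W\<close> is the free module on the set \<open>V \<times> W\<close> modulo the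
  submodule generated by the bilinearity relations; its elements are cosets of that submodule.
  Elements of the free module are functions vanishing outside a finite subset of
  \<open>carrier V \<times> carrier W\<close>.  The fields \<open>mult\<close> and \<open>one\<close> of the records \<open>free_module\<close> and
  \<open>tensor_module\<close> play no role.
\<close>

definition free_module :: "('k, 'm) ring_scheme \<Rightarrow> 's set \<Rightarrow> ('k, 's \<Rightarrow> 'k) module"
  where "free_module K S =
    \<lparr>carrier = {f. (\<forall>p \<in> S. f p \<in> carrier K) \<and> (\<forall>p. p \<notin> S \<longrightarrow> f p = \<zero>\<^bsub>K\<^esub>) \<and>
        finite {p. f p \<noteq> \<zero>\<^bsub>K\<^esub>}},
     monoid.mult = undefined, one = undefined,
     ring.zero = (\<lambda>_. \<zero>\<^bsub>K\<^esub>),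
     add = (\<lambda>f g p. f p \<oplus>\<^bsub>K\<^esub> g p),
     smult = (\<lambda>c f p. c \<otimes>\<^bsub>K\<^esub> f p)\<rparr>"

definition free_gen :: "('k, 'm) ring_scheme \<Rightarrow> 's \<Rightarrow> ('s \<Rightarrow> 'k)"
  where "free_gen K s = (\<lambda>p. if p = s then \<one>\<^bsub>K\<^esub> else \<zero>\<^bsub>K\<^esub>)"

definition bilinear_relations ::
  "('k, 'm) ring_scheme \<Rightarrow> ('k, 'a, 'n) module_scheme \<Rightarrow> ('k, 'b, 'p) module_scheme \<Rightarrow> ('a \<times> 'b \<Rightarrow> 'k) set"
  where "bilinear_relations K V W =
    (let F = free_module K (carrier V \<times> carrier W); e = (\<lambda>v w. free_gen K (v, w)) in
      {e (v \<oplus>\<^bsub>V\<^esub> v') w \<ominus>\<^bsub>F\<^esub> (e v w \<oplus>\<^bsub>F\<^esub> e v' w) | v v' w.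
          v \<in> carrier V \<and> v' \<in> carrier V \<and> w \<in> carrier W} \<union>
      {e v (w \<oplus>\<^bsub>W\<^esub> w') \<ominus>\<^bsub>F\<^esub> (e v w \<oplus>\<^bsub>F\<^esub> e v w') | v w w'.
          v \<in> carrier V \<and> w \<in> carrier W \<and> w' \<in> carrier W} \<union>
      {e (c \<odot>\<^bsub>V\<^esub> v) w \<ominus>\<^bsub>F\<^esub> c \<odot>\<^bsub>F\<^esub> e v w | c v w.
          c \<in> carrier K \<and> v \<in> carrier V \<and> w \<in> carrier W} \<union>
      {e v (c \<odot>\<^bsub>W\<^esub> w) \<ominus>\<^bsub>F\<^esub> c \<odot>\<^bsub>F\<^esub> e v w | c v w.
          c \<in> carrier K \<and> v \<in> carrier V \<and> w \<in> carrier W})"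

definition bilinear_submodule ::
  "('k, 'm) ring_scheme \<Rightarrow> ('k, 'a, 'n) module_scheme \<Rightarrow> ('k, 'b, 'p) module_scheme \<Rightarrow> ('a \<times> 'b \<Rightarrow> 'k) set"
  where "bilinear_submodule K V W =
    (\<lambda>N. submodule N K (free_module K (carrier V \<times> carrier W))) hull bilinear_relations K V W"

definition tensor_module ::
  "('k, 'm) ring_scheme \<Rightarrow> ('k, 'a, 'n) module_scheme \<Rightarrow> ('k, 'b, 'p) module_scheme \<Rightarrow>
    ('k, ('a \<times> 'b \<Rightarrow> 'k) set) module"
  where "tensor_module K V W =
    (let F = free_module K (carrier V \<times> carrier W); N = bilinear_submodule K V W in
      \<lparr>carrier = a_rcosets\<^bsub>F\<^esub> N,
       monoid.mult = undefined, one = undefined,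
       ring.zero = N,
       add = (\<lambda>P Q. P <+>\<^bsub>F\<^esub> Q),
       smult = (\<lambda>c P. \<Union>x \<in> P. N +>\<^bsub>F\<^esub> (c \<odot>\<^bsub>F\<^esub> x))\<rparr>)"

definition tens ::
  "('k, 'm) ring_scheme \<Rightarrow> ('k, 'a, 'n) module_scheme \<Rightarrow> ('k, 'b, 'p) module_scheme \<Rightarrow>
    'a \<Rightarrow> 'b \<Rightarrow> ('a \<times> 'b \<Rightarrow> 'k) set"
  where "tens K V W v w =
    bilinear_submodule K V W +>\<^bsub>free_module K (carrier V \<times> carrier W)\<^esub> free_gen K (v, w)"

text \<open>
  The linear map from the tensor product of \<open>V\<close> and \<open>W\<close> to \<open>M\<close> induced by \<open>\<beta>\<close>: it sends the
  class of \<open>\<Sum> c\<^sub>i (v\<^sub>i, w\<^sub>i)\<close> to \<open>\<Sum> c\<^sub>i \<beta> v\<^sub>i w\<^sub>i\<close>.  For bilinear \<open>\<beta>\<close>, the only case used below,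
  this does not depend on the representative.
\<close>

definition tensor_lift ::
  "('k, 'm) ring_scheme \<Rightarrow> ('k, 'c, 'n) module_scheme \<Rightarrow> ('a \<Rightarrow> 'b \<Rightarrow> 'c) \<Rightarrow> ('a \<times> 'b \<Rightarrow> 'k) set \<Rightarrow> 'c"
  where "tensor_lift K M \<beta> P =
    (let x = (SOME x. x \<in> P) in
      \<Oplus>\<^bsub>M\<^esub>p \<in> {p. x p \<noteq> \<zero>\<^bsub>K\<^esub>}. x p \<odot>\<^bsub>M\<^esub> \<beta> (fst p) (snd p))"

definition tensor_map ::
  "('k, 'm) ring_scheme \<Rightarrow> ('k, 'c, 'n) module_scheme \<Rightarrow> ('k, 'd, 'p) module_scheme \<Rightarrow>
    ('a \<Rightarrow> 'c) \<Rightarrow> ('b \<Rightarrow> 'd) \<Rightarrow> ('a \<times> 'b \<Rightarrow> 'k) set \<Rightarrow> ('c \<times> 'd \<Rightarrow> 'k) set"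
  where "tensor_map K V' W' f g =
    tensor_lift K (tensor_module K V' W') (\<lambda>v w. tens K V' W' (f v) (g w))"

text \<open>
  The algebra structure is determined by \<open>(a \<otimes> b)(c \<otimes> d) = ac \<otimes> bd\<close>.  Since multiplication
  does not enter \<open>tensor_module\<close>, the tensor products of \<open>A\<close> or its opposite with \<open>A\<close> or its
  opposite all have literally the same underlying module.
\<close>

definition tensor_alg ::
  "('k, 'm) ring_scheme \<Rightarrow> ('k, 'a, 'n) module_scheme \<Rightarrow> ('k, 'b, 'p) module_scheme \<Rightarrow>
    ('k, ('a \<times> 'b \<Rightarrow> 'k) set) module"
  where "tensor_alg K A B =
    (let T = tensor_module K A B in
      T\<lparr>monoid.mult := (\<lambda>P Q. tensor_lift K T (\<lambda>a b.
          tensor_lift K T (\<lambda>c d. tens K A B (a \<otimes>\<^bsub>A\<^esub> c) (b \<otimes>\<^bsub>B\<^esub> d)) Q) P),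
        one := tens K A B \<one>\<^bsub>A\<^esub> \<one>\<^bsub>B\<^esub>\<rparr>)"

abbreviation tensor_alg3 ::
  "('k, 'm) ring_scheme \<Rightarrow> ('k, 'a, 'n) module_scheme \<Rightarrow>
    ('k, ('a \<times> ('a \<times> 'a \<Rightarrow> 'k) set \<Rightarrow> 'k) set) module"
  where "tensor_alg3 K A \<equiv> tensor_alg K A (tensor_alg K A A)"

definition tens3 ::
  "('k, 'm) ring_scheme \<Rightarrow> ('k, 'a, 'n) module_scheme \<Rightarrow> 'a \<Rightarrow> 'a \<Rightarrow> 'a \<Rightarrow>
    ('a \<times> ('a \<times> 'a \<Rightarrow> 'k) set \<Rightarrow> 'k) set"
  where "tens3 K A x y z = tens K A (tensor_alg K A A) x (tens K A A y z)"

definition leg12 where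
  "leg12 K A = tensor_lift K (tensor_alg3 K A) (\<lambda>a b. tens3 K A a b \<one>\<^bsub>A\<^esub>)"

definition leg13 where
  "leg13 K A = tensor_lift K (tensor_alg3 K A) (\<lambda>a b. tens3 K A a \<one>\<^bsub>A\<^esub> b)"

definition leg23 where
  "leg23 K A = tensor_lift K (tensor_alg3 K A) (\<lambda>a b. tens3 K A \<one>\<^bsub>A\<^esub> a b)"

definition yang_baxter ::
  "('k, 'm) ring_scheme \<Rightarrow> ('k, 'a, 'n) module_scheme \<Rightarrow> ('a \<times> 'a \<Rightarrow> 'k) set \<Rightarrow> bool"
  where "yang_baxter K A \<rho> \<longleftrightarrow>
    leg12 K A \<rho> \<otimes>\<^bsub>tensor_alg3 K A\<^esub> leg13 K A \<rho> \<otimes>\<^bsub>tensor_alg3 K A\<^esub> leg23 K A \<rho> =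
    leg23 K A \<rho> \<otimes>\<^bsub>tensor_alg3 K A\<^esub> leg13 K A \<rho> \<otimes>\<^bsub>tensor_alg3 K A\<^esub> leg12 K A \<rho>"


section \<open>Quantum algebras and oriented quantum algebras\<close>

locale quantum_algebra = k_algebra K A
  for K :: "('k, 'm) ring_scheme" (structure) and A :: "('k, 'a, 'n) module_scheme" (structure) +
  fixes \<rho> :: "('a \<times> 'a \<Rightarrow> 'k) set" and s :: "'a \<Rightarrow> 'a"
  assumes rho_Units: "\<rho> \<in> Units (tensor_alg K A A)"
    and s_iso: "s \<in> alg_iso K A (opposite A)"
    and inv_rho: "inv\<^bsub>tensor_alg K A A\<^esub> \<rho> = tensor_map K A A s id \<rho>"
    and rho_s_s: "\<rho> = tensor_map K A A s s \<rho>"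
    and yang_baxter: "yang_baxter K A \<rho>"

locale oriented_quantum_algebra = k_algebra K A
  for K :: "('k, 'm) ring_scheme" (structure) and A :: "('k, 'a, 'n) module_scheme" (structure) +
  fixes \<rho> :: "('a \<times> 'a \<Rightarrow> 'k) set" and td tu :: "'a \<Rightarrow> 'a"
  assumes rho_Units: "\<rho> \<in> Units (tensor_alg K A A)"
    and td_auto: "td \<in> alg_iso K A A"
    and tu_auto: "tu \<in> alg_iso K A A"
    and td_tu_commute: "x \<in> carrier A \<Longrightarrow> td (tu x) = tu (td x)"
    and inverses:
      "tensor_map K A A td id (inv\<^bsub>tensor_alg K A A\<^esub> \<rho>) \<otimes>\<^bsub>tensor_alg K A (opposite A)\<^esub>
          tensor_map K A A id tu \<rho> = \<one>\<^bsub>tensor_alg K A (opposite A)\<^esub>"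
      "tensor_map K A A id tu \<rho> \<otimes>\<^bsub>tensor_alg K A (opposite A)\<^esub>
          tensor_map K A A td id (inv\<^bsub>tensor_alg K A A\<^esub> \<rho>) = \<one>\<^bsub>tensor_alg K A (opposite A)\<^esub>"
    and rho_td_td: "\<rho> = tensor_map K A A td td \<rho>"
    and rho_tu_tu: "\<rho> = tensor_map K A A tu tu \<rho>"
    and yang_baxter: "yang_baxter K A \<rho>"

locale oriented_quantum_algebra_morphism =
  source: oriented_quantum_algebra K A \<rho> td tu + target: oriented_quantum_algebra K A' \<rho>' td' tu'
  for K :: "('k, 'm) ring_scheme"
    and A :: "('k, 'a, 'n) module_scheme" and \<rho> and td tu :: "'a \<Rightarrow> 'a"
    and A' :: "('k, 'b, 'p) module_scheme" and \<rho>' and td' tu' :: "'b \<Rightarrow> 'b" +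
  fixes f :: "'a \<Rightarrow> 'b"
  assumes f_hom: "f \<in> alg_hom K A A'"
    and f_rho: "\<rho>' = tensor_map K A' A' f f \<rho>"
    and f_td: "x \<in> carrier A \<Longrightarrow> td' (f x) = f (td x)"
    and f_tu: "x \<in> carrier A \<Longrightarrow> tu' (f x) = f (tu x)"


section \<open>The double \<open>A \<oplus> A\<^sup>o\<^sup>p\<close>\<close>

definition double_alg :: "('k, 'a, 'n) module_scheme \<Rightarrow> ('k, 'a \<times> 'a) module"
  where "double_alg A = alg_prod A (opposite A)"

definition emb :: "('k, 'a, 'n) module_scheme \<Rightarrow> 'a \<Rightarrow> 'a \<times> 'a"
  where "emb A a = (a, \<zero>\<^bsub>A\<^esub>)"

definition bar :: "'a \<times> 'a \<Rightarrow> 'a \<times> 'a"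
  where "bar x = (snd x, fst x)"

definition td_inv_tu_inv :: "('k, 'a, 'n) module_scheme \<Rightarrow> ('a \<Rightarrow> 'a) \<Rightarrow> ('a \<Rightarrow> 'a) \<Rightarrow> 'a \<Rightarrow> 'a"
  where "td_inv_tu_inv A td tu = inv_into (carrier A) td \<circ> inv_into (carrier A) tu"

text \<open>
  The arguments \<open>a b\<close> and \<open>\<alpha> \<beta>\<close> are the components of chosen expressions
  \<open>\<Sum>i=1..r. a i \<otimes> b i\<close> of \<open>\<rho>\<close> and \<open>\<Sum>j=1..n. \<alpha> j \<otimes> \<beta> j\<close> of its inverse.
\<close>

definition double_rho ::
  "('k, 'm) ring_scheme \<Rightarrow> ('k, 'a, 'n) module_scheme \<Rightarrow> ('a \<Rightarrow> 'a) \<Rightarrow> ('a \<Rightarrow> 'a) \<Rightarrow>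
    nat \<Rightarrow> (nat \<Rightarrow> 'a) \<Rightarrow> (nat \<Rightarrow> 'a) \<Rightarrow> nat \<Rightarrow> (nat \<Rightarrow> 'a) \<Rightarrow> (nat \<Rightarrow> 'a) \<Rightarrow>
    (('a \<times> 'a) \<times> ('a \<times> 'a) \<Rightarrow> 'k) set"
  where "double_rho K A td tu r a b n \<alpha> \<beta> =
    (let D = double_alg A; DD = tensor_alg K D D in
      (\<Oplus>\<^bsub>DD\<^esub>i \<in> {1..r}.
          tens K D D (emb A (a i)) (emb A (b i)) \<oplus>\<^bsub>DD\<^esub>
          tens K D D (bar (emb A (a i))) (bar (emb A (b i)))) \<oplus>\<^bsub>DD\<^esub>
      (\<Oplus>\<^bsub>DD\<^esub>j \<in> {1..n}.
          tens K D D (bar (emb A (\<alpha> j))) (emb A (\<beta> j)) \<oplus>\<^bsub>DD\<^esub>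
          tens K D D (emb A (\<alpha> j)) (bar (emb A (td_inv_tu_inv A td tu (\<beta> j))))))"

definition double_s :: "('k, 'a, 'n) module_scheme \<Rightarrow> ('a \<Rightarrow> 'a) \<Rightarrow> ('a \<Rightarrow> 'a) \<Rightarrow> 'a \<times> 'a \<Rightarrow> 'a \<times> 'a"
  where "double_s A td tu = (\<lambda>(a, b). (b, td_inv_tu_inv A td tu a))"

definition double_t :: "('a \<Rightarrow> 'a) \<Rightarrow> 'a \<times> 'a \<Rightarrow> 'a \<times> 'a"
  where "double_t t = (\<lambda>(a, b). (t a, t b))"

end

theory Submission
  imports Defs
begin

text \<open>
  Write \<open>D = A \<oplus> A\<^sup>o\<^sup>p\<close>.  The two projections of \<open>D\<close> induce unital algebra maps from \<open>D \<otimes> D\<close> to the four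
  algebras \<open>A\<^sup>x \<otimes> A\<^sup>y\<close> and from \<open>D \<otimes> D \<otimes> D\<close> to the eight algebras \<open>A\<^sup>x \<otimes> A\<^sup>y \<otimes> A\<^sup>z\<close>, where each exponent
  selects \<open>A\<close> or its opposite.  These maps are jointly injective, so every identity may be checked
  block by block.  All blocks share one underlying space, and passing to the opposite algebra in one
  tensor slot reverses the order of the two legs meeting there.  This turns six of the eight
  Yang--Baxter blocks into rearrangements of the equation for \<open>\<rho>\<close> in \<open>A \<otimes> A \<otimes> A\<close>.  In the remaining two
  the legs are ordered cyclically; there \<open>\<rho>\<^sub>1\<^sub>2\<close> is first inverted, using the axiom that relates
  \<open>(t\<^sub>d \<otimes> 1)(\<rho>\<^sup>-\<^sup>1)\<close> and \<open>(1 \<otimes> t\<^sub>u)(\<rho>)\<close> in \<open>A \<otimes> A\<^sup>o\<^sup>p\<close>.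
\<close>

section \<open>Linear maps and free modules\<close>

text \<open>Let \<tau> be the inverse of td o tu. The twist in the doubled R-matrix R is forced. If
  (s \<otimes> 1)(R) is to invert R, where s exchanges the two factors, then the A \<otimes> A^op
  block of the inverse is the A^op \<otimes> A^op block of R, which is \<rho>. So the A \<otimes>
  A^op block of R must be the inverse of \<rho> in A \<otimes> A^op. The orientation axiom
  identifies it as (1 \<otimes> \<tau>)(\<rho>^-1), after applying 1 \<otimes> td and 1 \<otimes>
  \<tau> and using the invariance of \<rho>. The same computation inverts \<rho>^-1 in A^op
  \<otimes> A, with result (\<tau> \<otimes> 1)(\<rho>). This is what makes the first leg invertible
  in the two cyclic Yang--Baxter blocks. Joint injectivity of the block maps also needs care:
  injectivity does not pass to tensor products by formal means. The projections are therefore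
  accompanied by linear sections, and the equation saying that the composites add up to the identity
  survives tensoring. Exponents are Booleans, so that most arguments treat all blocks uniformly and
  cases are split only where \<rho> itself enters.\<close>

definition lin_map ::
  "('k, 'm) ring_scheme \<Rightarrow> ('k, 'a, 'n) module_scheme \<Rightarrow> ('k, 'b, 'p) module_scheme \<Rightarrow> ('a \<Rightarrow> 'b) set"
  where "lin_map K V W = {h \<in> carrier V \<rightarrow> carrier W.
    (\<forall>x \<in> carrier V. \<forall>y \<in> carrier V. h (x \<oplus>\<^bsub>V\<^esub> y) = h x \<oplus>\<^bsub>W\<^esub> h y) \<and>
    (\<forall>c \<in> carrier K. \<forall>x \<in> carrier V. h (c \<odot>\<^bsub>V\<^esub> x) = c \<odot>\<^bsub>W\<^esub> h x)}"

definition bilin_map ::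
  "('k, 'm) ring_scheme \<Rightarrow> ('k, 'a, 'n) module_scheme \<Rightarrow> ('k, 'b, 'p) module_scheme \<Rightarrow>
    ('k, 'c, 'q) module_scheme \<Rightarrow> ('a \<Rightarrow> 'b \<Rightarrow> 'c) set"
  where "bilin_map K V W M = {\<beta>. (\<forall>v \<in> carrier V. \<beta> v \<in> lin_map K W M) \<and>
    (\<forall>w \<in> carrier W. (\<lambda>v. \<beta> v w) \<in> lin_map K V M)}"

lemma lin_mapI:
  assumes "\<And>x. x \<in> carrier V \<Longrightarrow> h x \<in> carrier W"
    and "\<And>x y. \<lbrakk>x \<in> carrier V; y \<in> carrier V\<rbrakk> \<Longrightarrow> h (x \<oplus>\<^bsub>V\<^esub> y) = h x \<oplus>\<^bsub>W\<^esub> h y"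
    and "\<And>c x. \<lbrakk>c \<in> carrier K; x \<in> carrier V\<rbrakk> \<Longrightarrow> h (c \<odot>\<^bsub>V\<^esub> x) = c \<odot>\<^bsub>W\<^esub> h x"
  shows "h \<in> lin_map K V W"
  using assms by (simp add: lin_map_def)

lemma lin_mapD:
  assumes "h \<in> lin_map K V W"
  shows lin_map_closed: "x \<in> carrier V \<Longrightarrow> h x \<in> carrier W"
    and lin_map_add: "\<lbrakk>x \<in> carrier V; y \<in> carrier V\<rbrakk> \<Longrightarrow> h (x \<oplus>\<^bsub>V\<^esub> y) = h x \<oplus>\<^bsub>W\<^esub> h y"
    and lin_map_smult: "\<lbrakk>c \<in> carrier K; x \<in> carrier V\<rbrakk> \<Longrightarrow> h (c \<odot>\<^bsub>V\<^esub> x) = c \<odot>\<^bsub>W\<^esub> h x"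
  using assms by (auto simp: lin_map_def)

lemma lin_map_comp:
  "\<lbrakk>g \<in> lin_map K V W; h \<in> lin_map K W M\<rbrakk> \<Longrightarrow> (\<lambda>x. h (g x)) \<in> lin_map K V M"
  by (auto simp: lin_map_def Pi_iff)

lemma lin_map_zero:
  assumes "module K V" "module K W" "h \<in> lin_map K V W"
  shows "h \<zero>\<^bsub>V\<^esub> = \<zero>\<^bsub>W\<^esub>"
proof -
  interpret V: module K V by fact
  interpret W: module K W by fact
  have "h (\<zero>\<^bsub>K\<^esub> \<odot>\<^bsub>V\<^esub> \<zero>\<^bsub>V\<^esub>) = \<zero>\<^bsub>K\<^esub> \<odot>\<^bsub>W\<^esub> h \<zero>\<^bsub>V\<^esub>"
    by (rule lin_map_smult[OF assms(3)]) simp_all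
  then show ?thesis
    using lin_map_closed[OF assms(3)] by simp
qed

lemma lin_map_finsum:
  assumes "module K V" "module K W" "h \<in> lin_map K V W" "f \<in> I \<rightarrow> carrier V"
  shows "h (\<Oplus>\<^bsub>V\<^esub>i\<in>I. f i) = (\<Oplus>\<^bsub>W\<^esub>i\<in>I. h (f i))"
proof -
  interpret V: module K V by fact
  interpret W: module K W by fact
  show ?thesis using assms(4)
    \<comment> \<open>An infinite index set is harmless: both sums default to zero, which
      \<open>h\<close> preserves.\<close>
    by (induction I rule: infinite_finite_induct)
      (auto simp: lin_map_zero[OF assms(1-3)] lin_map_add[OF assms(3)] lin_map_closed[OF assms(3)] Pi_iff)
qed

lemma free_module_sel [simp]:
  "f \<in> carrier (free_module K S) \<longleftrightarrow> (\<forall>p \<in> S. f p \<in> carrier K) \<and>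
     (\<forall>p. p \<notin> S \<longrightarrow> f p = \<zero>\<^bsub>K\<^esub>) \<and> finite {p. f p \<noteq> \<zero>\<^bsub>K\<^esub>}"
  "\<zero>\<^bsub>free_module K S\<^esub> = (\<lambda>_. \<zero>\<^bsub>K\<^esub>)"
  "f \<oplus>\<^bsub>free_module K S\<^esub> g = (\<lambda>p. f p \<oplus>\<^bsub>K\<^esub> g p)"
  "c \<odot>\<^bsub>free_module K S\<^esub> f = (\<lambda>p. c \<otimes>\<^bsub>K\<^esub> f p)"
  by (simp_all add: free_module_def)

lemma (in cring) free_module_closed:
  "f \<in> carrier (free_module R S) \<Longrightarrow> f p \<in> carrier R"
  by (cases "p \<in> S") auto

lemma (in cring) finite_support_add:
  assumes "finite {p. f p \<noteq> \<zero>}" "finite {p. g p \<noteq> \<zero>}"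
  shows "finite {p. f p \<oplus> g p \<noteq> \<zero>}"
  by (rule finite_subset[OF _ finite_UnI[OF assms]]) auto

lemma (in cring) finite_support_smult:
  assumes "finite {p. f p \<noteq> \<zero>}" "c \<in> carrier R"
  shows "finite {p. c \<otimes> f p \<noteq> \<zero>}"
  by (rule finite_subset[OF _ assms(1)]) (use assms(2) in auto)

lemma (in cring) module_free_module: "module R (free_module R S)"
proof (rule moduleI)
  let ?F = "free_module R S"
  note closed = free_module_closed[where S = S]
  show "abelian_group ?F"
  proof (rule abelian_groupI)
    fix x y assume "x \<in> carrier ?F" "y \<in> carrier ?F"
    then show "x \<oplus>\<^bsub>?F\<^esub> y \<in> carrier ?F"
      using finite_support_add[of x y] by auto
  next
    fix x y z assume "x \<in> carrier ?F" "y \<in> carrier ?F" "z \<in> carrier ?F"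
    then have "\<And>p. x p \<in> carrier R" "\<And>p. y p \<in> carrier R" "\<And>p. z p \<in> carrier R"
      using closed by blast+
    then show "x \<oplus>\<^bsub>?F\<^esub> y \<oplus>\<^bsub>?F\<^esub> z = x \<oplus>\<^bsub>?F\<^esub> (y \<oplus>\<^bsub>?F\<^esub> z)"
      and "x \<oplus>\<^bsub>?F\<^esub> y = y \<oplus>\<^bsub>?F\<^esub> x"
      by (auto simp: a_assoc intro: a_comm)
  next
    fix x assume x: "x \<in> carrier ?F"
    then have c: "\<And>p. x p \<in> carrier R" using closed by blast
    then show "\<zero>\<^bsub>?F\<^esub> \<oplus>\<^bsub>?F\<^esub> x = x" by simp
    have "{p. \<ominus> x p \<noteq> \<zero>} \<subseteq> {p. x p \<noteq> \<zero>}" by auto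
    then have "(\<lambda>p. \<ominus> x p) \<in> carrier ?F" using x c by (auto intro: finite_subset)
    moreover have "(\<lambda>p. \<ominus> x p) \<oplus>\<^bsub>?F\<^esub> x = \<zero>\<^bsub>?F\<^esub>" using c by (simp add: l_neg)
    ultimately show "\<exists>y \<in> carrier ?F. y \<oplus>\<^bsub>?F\<^esub> x = \<zero>\<^bsub>?F\<^esub>" by blast
  qed auto
next
  let ?F = "free_module R S"
  fix c x assume c: "c \<in> carrier R" "x \<in> carrier ?F"
  then show "c \<odot>\<^bsub>?F\<^esub> x \<in> carrier ?F"
    using finite_support_smult[of x c] by auto
next
  let ?F = "free_module R S"
  note closed = free_module_closed[where S = S]
  fix a b x y assume "a \<in> carrier R" "b \<in> carrier R" and x: "x \<in> carrier ?F"
  then show "(a \<oplus> b) \<odot>\<^bsub>?F\<^esub> x = a \<odot>\<^bsub>?F\<^esub> x \<oplus>\<^bsub>?F\<^esub> b \<odot>\<^bsub>?F\<^esub> x"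
    and "(a \<otimes> b) \<odot>\<^bsub>?F\<^esub> x = a \<odot>\<^bsub>?F\<^esub> (b \<odot>\<^bsub>?F\<^esub> x)"
    using closed[OF x] by (simp_all add: l_distr m_assoc)
next
  let ?F = "free_module R S"
  note closed = free_module_closed[where S = S]
  fix a x y assume "a \<in> carrier R" and x: "x \<in> carrier ?F" "y \<in> carrier ?F"
  then show "a \<odot>\<^bsub>?F\<^esub> (x \<oplus>\<^bsub>?F\<^esub> y) = a \<odot>\<^bsub>?F\<^esub> x \<oplus>\<^bsub>?F\<^esub> a \<odot>\<^bsub>?F\<^esub> y"
    using closed[OF x(1)] closed[OF x(2)] by (simp add: r_distr)
next
  fix x assume x: "x \<in> carrier (free_module R S)"
  show "\<one> \<odot>\<^bsub>free_module R S\<^esub> x = x"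
    using free_module_closed[OF x] by simp
qed (rule is_cring)

lemma (in cring) free_gen_closed [simp]: "s \<in> S \<Longrightarrow> free_gen R s \<in> carrier (free_module R S)"
  by (auto simp: free_gen_def)

text \<open>Induction on the support: after splitting off the term at \<open>s\<close>, the
  remainder \<open>f(s := \<zero>)\<close> has strictly smaller support.\<close>

lemma (in cring) free_module_induct [consumes 1, case_names zero add]:
  assumes "f \<in> carrier (free_module R S)"
    and zero: "P \<zero>\<^bsub>free_module R S\<^esub>"
    and add: "\<And>c s g. \<lbrakk>c \<in> carrier R; s \<in> S; g \<in> carrier (free_module R S); P g\<rbrakk> \<Longrightarrow>
      P (c \<odot>\<^bsub>free_module R S\<^esub> free_gen R s \<oplus>\<^bsub>free_module R S\<^esub> g)"
  shows "P f"
proof -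
  have "finite {p. f p \<noteq> \<zero>}" using assms(1) by simp
  then show ?thesis using assms(1)
  proof (induction "{p. f p \<noteq> \<zero>}" arbitrary: f rule: finite_psubset_induct)
    case (psubset f)
    note c = free_module_closed[OF psubset.prems]
    show ?case
    proof (cases "\<exists>s. f s \<noteq> \<zero>")
      case False
      then have "f = \<zero>\<^bsub>free_module R S\<^esub>" by auto
      then show ?thesis using zero by simp
    next
      case True
      then obtain s where s: "f s \<noteq> \<zero>" by blast
      let ?g = "f(s := \<zero>)"
      have sub: "{p. ?g p \<noteq> \<zero>} \<subset> {p. f p \<noteq> \<zero>}" using s by auto
      have sS: "s \<in> S" using s psubset.prems by auto
      have g: "?g \<in> carrier (free_module R S)"
        using psubset.prems finite_subset[of "{p. ?g p \<noteq> \<zero>}" "{p. f p \<noteq> \<zero>}"] sub by auto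
      have f: "f s \<odot>\<^bsub>free_module R S\<^esub> free_gen R s \<oplus>\<^bsub>free_module R S\<^esub> ?g = f"
        using c by (auto simp: free_gen_def)
      show ?thesis using add[OF c[of s] sS g psubset.hyps(2)[OF sub g]] unfolding f .
    qed
  qed
qed

section \<open>Linear extension from generators\<close>

definition free_lift ::
  "('k, 'm) ring_scheme \<Rightarrow> ('k, 'c, 'n) module_scheme \<Rightarrow> ('s \<Rightarrow> 'c) \<Rightarrow> ('s \<Rightarrow> 'k) \<Rightarrow> 'c"
  where "free_lift K M b f = (\<Oplus>\<^bsub>M\<^esub>p \<in> {p. f p \<noteq> \<zero>\<^bsub>K\<^esub>}. f p \<odot>\<^bsub>M\<^esub> b p)"

context module
begin

text \<open>Cancellation can shrink supports, so the sums for \<open>f\<close>, \<open>g\<close> and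
  their sum run over different sets. Padding with zero terms to one common finite set makes them
  comparable.\<close>

lemma free_lift_superset:
  assumes "f \<in> carrier (free_module R S)" "b \<in> S \<rightarrow> carrier M"
    and "finite Y" "{p. f p \<noteq> \<zero>} \<subseteq> Y" "Y \<subseteq> S"
  shows "free_lift R M b f = (\<Oplus>\<^bsub>M\<^esub>p \<in> Y. f p \<odot>\<^bsub>M\<^esub> b p)"
  unfolding free_lift_def
  using assms
  by (intro M.add.finprod_mono_neutral_cong_left) (auto simp: Pi_iff)

lemma free_lift_lin:
  assumes b: "b \<in> S \<rightarrow> carrier M"
  shows "free_lift R M b \<in> lin_map R (free_module R S) M"
proof -
  let ?F = "free_module R S"
  interpret F: module R ?F by (rule module_free_module)
  have supp: "{p. f p \<noteq> \<zero>} \<subseteq> S" if "f \<in> carrier ?F" for f using that by auto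
  have bc: "b p \<in> carrier M" if "p \<in> S" for p using b that by auto
  show ?thesis
  proof (rule lin_mapI)
    fix f assume f: "f \<in> carrier ?F"
    then show "free_lift R M b f \<in> carrier M"
      using supp[OF f] free_module_closed[OF f] bc
      by (auto simp: free_lift_def intro!: M.finsum_closed)
  next
    fix f g assume f: "f \<in> carrier ?F" and g: "g \<in> carrier ?F"
    let ?X = "{p. f p \<noteq> \<zero>} \<union> {p. g p \<noteq> \<zero>}"
    have X: "finite ?X" "?X \<subseteq> S" using f g by auto
    note c = free_module_closed[OF f] free_module_closed[OF g]
    have "free_lift R M b (f \<oplus>\<^bsub>?F\<^esub> g) = (\<Oplus>\<^bsub>M\<^esub>p \<in> ?X. (f \<oplus>\<^bsub>?F\<^esub> g) p \<odot>\<^bsub>M\<^esub> b p)"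
      using F.M.a_closed[OF f g] b X by (intro free_lift_superset) auto
    also have "\<dots> = (\<Oplus>\<^bsub>M\<^esub>p \<in> ?X. f p \<odot>\<^bsub>M\<^esub> b p \<oplus>\<^bsub>M\<^esub> g p \<odot>\<^bsub>M\<^esub> b p)"
      using X(2) c bc by (intro M.finsum_cong') (auto simp: smult_l_distr)
    also have "\<dots> = (\<Oplus>\<^bsub>M\<^esub>p \<in> ?X. f p \<odot>\<^bsub>M\<^esub> b p) \<oplus>\<^bsub>M\<^esub> (\<Oplus>\<^bsub>M\<^esub>p \<in> ?X. g p \<odot>\<^bsub>M\<^esub> b p)"
      using X(2) c bc by (intro M.finsum_addf) auto
    also have "\<dots> = free_lift R M b f \<oplus>\<^bsub>M\<^esub> free_lift R M b g"
      using free_lift_superset[OF f b X(1) _ X(2)] free_lift_superset[OF g b X(1) _ X(2)] by simp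
    finally show "free_lift R M b (f \<oplus>\<^bsub>?F\<^esub> g) = free_lift R M b f \<oplus>\<^bsub>M\<^esub> free_lift R M b g" .
  next
    fix c f assume c: "c \<in> carrier R" and f: "f \<in> carrier ?F"
    let ?X = "{p. f p \<noteq> \<zero>}"
    note fc = free_module_closed[OF f]
    have X: "finite ?X" using f by simp
    have "free_lift R M b (c \<odot>\<^bsub>?F\<^esub> f) = (\<Oplus>\<^bsub>M\<^esub>p \<in> ?X. (c \<odot>\<^bsub>?F\<^esub> f) p \<odot>\<^bsub>M\<^esub> b p)"
      using F.smult_closed[OF c f] b X supp[OF f] c by (intro free_lift_superset) auto
    also have "\<dots> = (\<Oplus>\<^bsub>M\<^esub>p \<in> ?X. c \<odot>\<^bsub>M\<^esub> (f p \<odot>\<^bsub>M\<^esub> b p))"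
      using supp[OF f] fc bc c by (intro M.finsum_cong') (auto simp: smult_assoc1)
    also have "\<dots> = c \<odot>\<^bsub>M\<^esub> free_lift R M b f"
      unfolding free_lift_def
      using supp[OF f] fc bc c X by (intro finsum_smult_ldistr[symmetric]) auto
    finally show "free_lift R M b (c \<odot>\<^bsub>?F\<^esub> f) = c \<odot>\<^bsub>M\<^esub> free_lift R M b f" .
  qed
qed

lemma free_lift_gen:
  assumes "b \<in> S \<rightarrow> carrier M" "s \<in> S"
  shows "free_lift R M b (free_gen R s) = b s"
proof -
  have "free_lift R M b (free_gen R s) = (\<Oplus>\<^bsub>M\<^esub>p \<in> {s}. free_gen R s p \<odot>\<^bsub>M\<^esub> b p)"
    using assms by (intro free_lift_superset[where S = S]) (auto simp: free_gen_def)
  also have "\<dots> = b s"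
    using assms by (auto simp: free_gen_def Pi_iff)
  finally show ?thesis .
qed

end

declare free_module_sel [simp del]

section \<open>The tensor product of modules\<close>

locale tensor_space = V: module K V + W: module K W
  for K :: "('k, 'm) ring_scheme" (structure)
    and V :: "('k, 'a, 'n) module_scheme" and W :: "('k, 'b, 'p) module_scheme"
begin

abbreviation "F \<equiv> free_module K (carrier V \<times> carrier W)"
abbreviation "N \<equiv> bilinear_submodule K V W"
abbreviation "T \<equiv> tensor_module K V W"
abbreviation "cls f \<equiv> N +>\<^bsub>F\<^esub> f"

sublocale F: module K F
  by (rule V.module_free_module)

lemma gen_closed: "\<lbrakk>v \<in> carrier V; w \<in> carrier W\<rbrakk> \<Longrightarrow> free_gen K (v, w) \<in> carrier F"
  by (rule V.free_gen_closed) simp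

lemma bilinear_relations_closed: "bilinear_relations K V W \<subseteq> carrier F"
  unfolding bilinear_relations_def Let_def
  by (auto intro!: gen_closed F.smult_closed F.M.minus_closed F.M.a_closed)

text \<open>An intersection of a nonempty family of submodules is a submodule; the family is
  nonempty because \<open>carrier F\<close> itself contains the relations.\<close>

lemma submodule_N: "submodule N K F"
proof -
  let ?S = "{N'. submodule N' K F \<and> bilinear_relations K V W \<subseteq> N'}"
  have N: "N = \<Inter>?S"
    by (simp add: bilinear_submodule_def hull_def)
  have "carrier F \<in> ?S"
    using F.carrier_is_submodule bilinear_relations_closed by simp
  then show ?thesis
    unfolding N
    by (intro F.submoduleI)
      (auto dest: F.submoduleE
        intro: F.submoduleE(3-5) subgroup.one_closed[OF submodule.axioms(1), simplified])
qed

lemma relations_N: "bilinear_relations K V W \<subseteq> N"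
  unfolding bilinear_submodule_def by (rule hull_subset)

lemma N_least: "\<lbrakk>submodule N' K F; bilinear_relations K V W \<subseteq> N'\<rbrakk> \<Longrightarrow> N \<subseteq> N'"
  unfolding bilinear_submodule_def by (rule hull_minimal)

sublocale N: abelian_subgroup N F
  by (rule abelian_subgroupI3)
    (auto intro: additive_subgroup.intro submodule.axioms(1)[OF submodule_N] F.M.abelian_group_axioms)

lemma tensor_carrier: "carrier T = cls ` carrier F"
  by (auto simp: tensor_module_def Let_def A_RCOSETS_def')

lemma cls_closed: "f \<in> carrier F \<Longrightarrow> cls f \<in> carrier T"
  by (simp add: tensor_carrier)

lemma cls_eqI: "\<lbrakk>f \<in> carrier F; g \<in> carrier F; f \<ominus>\<^bsub>F\<^esub> g \<in> N\<rbrakk> \<Longrightarrow> cls f = cls g"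
  by (rule N.a_repr_independence'[symmetric])
    (auto simp: N.a_rcos_module a_minus_def)

lemma tensor_add: "\<lbrakk>f \<in> carrier F; g \<in> carrier F\<rbrakk> \<Longrightarrow> cls f \<oplus>\<^bsub>T\<^esub> cls g = cls (f \<oplus>\<^bsub>F\<^esub> g)"
  unfolding tensor_module_def Let_def by (simp add: N.a_rcos_sum)

lemma tensor_zero: "\<zero>\<^bsub>T\<^esub> = cls \<zero>\<^bsub>F\<^esub>"
  unfolding tensor_module_def Let_def by (simp add: F.M.a_coset_add_zero[OF N.a_subset])

text \<open>The record forms a union of cosets over all representatives. Two representatives differ
  by an element of \<open>N\<close>, which is closed under scalars, so the union consists of a
  single coset.\<close>

lemma tensor_smult:
  assumes c: "c \<in> carrier K" and f: "f \<in> carrier F"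
  shows "c \<odot>\<^bsub>T\<^esub> cls f = cls (c \<odot>\<^bsub>F\<^esub> f)"
proof -
  have "cls (c \<odot>\<^bsub>F\<^esub> x) = cls (c \<odot>\<^bsub>F\<^esub> f)" if x: "x \<in> cls f" for x
  proof -
    from x obtain n where n: "n \<in> N" and xn: "x = n \<oplus>\<^bsub>F\<^esub> f"
      by (auto simp: a_r_coset_def')
    have nF: "n \<in> carrier F" using n N.a_subset by blast
    have "c \<odot>\<^bsub>F\<^esub> x \<ominus>\<^bsub>F\<^esub> c \<odot>\<^bsub>F\<^esub> f = c \<odot>\<^bsub>F\<^esub> n"
      unfolding xn using nF c f
      by (simp add: F.smult_r_distr a_minus_def F.M.a_assoc F.M.r_neg)
    also have "\<dots> \<in> N" using submodule.smult_closed[OF submodule_N c n] .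
    finally show ?thesis
      using nF c f unfolding xn by (intro cls_eqI) (simp_all)
  qed
  moreover have "f \<in> cls f" using f by (rule N.a_rcos_self)
  ultimately have "(\<Union>x \<in> cls f. cls (c \<odot>\<^bsub>F\<^esub> x)) = cls (c \<odot>\<^bsub>F\<^esub> f)"
    by blast
  then show ?thesis
    by (simp add: tensor_module_def Let_def)
qed

lemma module_tensor: "module K T"
proof (rule moduleI)
  show "abelian_group T"
    by (rule abelian_groupI)
      (auto simp: tensor_carrier tensor_add tensor_zero F.M.a_ac F.M.r_neg
        intro!: bexI[of _ "\<ominus>\<^bsub>F\<^esub> _"])
qed (auto simp: tensor_carrier tensor_add tensor_smult F.smult_l_distr F.smult_r_distr
      F.smult_assoc1 intro: V.is_cring V.R.is_cring)

sublocale T: module K T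
  by (rule module_tensor)

abbreviation tensor (infixl "\<otimes>\<^sub>t" 72) where "v \<otimes>\<^sub>t w \<equiv> tens K V W v w"

lemma tens_closed [simp, intro]: "\<lbrakk>v \<in> carrier V; w \<in> carrier W\<rbrakk> \<Longrightarrow> v \<otimes>\<^sub>t w \<in> carrier T"
  unfolding tens_def by (intro cls_closed gen_closed)

text \<open>Representatives of the two sides differ by exactly one defining relation; the three
  companion rules below hold for the same reason.\<close>

lemma tens_add_left:
  "\<lbrakk>v \<in> carrier V; v' \<in> carrier V; w \<in> carrier W\<rbrakk> \<Longrightarrow>
    (v \<oplus>\<^bsub>V\<^esub> v') \<otimes>\<^sub>t w = v \<otimes>\<^sub>t w \<oplus>\<^bsub>T\<^esub> v' \<otimes>\<^sub>t w"
  unfolding tens_def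
  apply (subst tensor_add)
    apply (simp_all add: gen_closed)
  apply (rule cls_eqI)
    apply (simp_all add: gen_closed)
  apply (rule subsetD[OF relations_N])
  unfolding bilinear_relations_def Let_def by blast

lemma tens_add_right:
  "\<lbrakk>v \<in> carrier V; w \<in> carrier W; w' \<in> carrier W\<rbrakk> \<Longrightarrow>
    v \<otimes>\<^sub>t (w \<oplus>\<^bsub>W\<^esub> w') = v \<otimes>\<^sub>t w \<oplus>\<^bsub>T\<^esub> v \<otimes>\<^sub>t w'"
  unfolding tens_def
  apply (subst tensor_add)
    apply (simp_all add: gen_closed)
  apply (rule cls_eqI)
    apply (simp_all add: gen_closed)
  apply (rule subsetD[OF relations_N])
  unfolding bilinear_relations_def Let_def by blast

lemma tens_smult_left:
  "\<lbrakk>c \<in> carrier K; v \<in> carrier V; w \<in> carrier W\<rbrakk> \<Longrightarrow>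
    (c \<odot>\<^bsub>V\<^esub> v) \<otimes>\<^sub>t w = c \<odot>\<^bsub>T\<^esub> (v \<otimes>\<^sub>t w)"
  unfolding tens_def
  apply (subst tensor_smult)
    apply (simp_all add: gen_closed)
  apply (rule cls_eqI)
    apply (simp_all add: gen_closed)
  apply (rule subsetD[OF relations_N])
  unfolding bilinear_relations_def Let_def by blast

lemma tens_smult_right:
  "\<lbrakk>c \<in> carrier K; v \<in> carrier V; w \<in> carrier W\<rbrakk> \<Longrightarrow>
    v \<otimes>\<^sub>t (c \<odot>\<^bsub>W\<^esub> w) = c \<odot>\<^bsub>T\<^esub> (v \<otimes>\<^sub>t w)"
  unfolding tens_def
  apply (subst tensor_smult)
    apply (simp_all add: gen_closed)
  apply (rule cls_eqI)
    apply (simp_all add: gen_closed)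
  apply (rule subsetD[OF relations_N])
  unfolding bilinear_relations_def Let_def by blast

lemma tens_bilin: "tens K V W \<in> bilin_map K V W T"
  by (auto simp: bilin_map_def tens_add_left tens_add_right tens_smult_left tens_smult_right
      intro!: lin_mapI)

lemma tens_zero_left: "w \<in> carrier W \<Longrightarrow> \<zero>\<^bsub>V\<^esub> \<otimes>\<^sub>t w = \<zero>\<^bsub>T\<^esub>"
  using lin_map_zero[OF V.module_axioms module_tensor, of "\<lambda>v. v \<otimes>\<^sub>t w"] tens_bilin
  by (simp add: bilin_map_def)

lemma tens_zero_right: "v \<in> carrier V \<Longrightarrow> v \<otimes>\<^sub>t \<zero>\<^bsub>W\<^esub> = \<zero>\<^bsub>T\<^esub>"
  using lin_map_zero[OF W.module_axioms module_tensor, of "\<lambda>w. v \<otimes>\<^sub>t w"] tens_bilin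
  by (simp add: bilin_map_def)

text \<open>Pure tensors and sums suffice: a scalar is absorbed into the left factor, and zero is
  itself the pure tensor of two zeros.\<close>

lemma tensor_induct [consumes 1, case_names tens add]:
  assumes "t \<in> carrier T"
    and tens: "\<And>v w. \<lbrakk>v \<in> carrier V; w \<in> carrier W\<rbrakk> \<Longrightarrow> P (v \<otimes>\<^sub>t w)"
    and add: "\<And>x y. \<lbrakk>x \<in> carrier T; y \<in> carrier T; P x; P y\<rbrakk> \<Longrightarrow> P (x \<oplus>\<^bsub>T\<^esub> y)"
  shows "P t"
proof -
  obtain f where t: "t = cls f" and f: "f \<in> carrier F"
    using assms(1) by (auto simp: tensor_carrier)
  from f show ?thesis unfolding t
  proof (induction rule: V.free_module_induct)
    case zero
    have "cls \<zero>\<^bsub>F\<^esub> = \<zero>\<^bsub>V\<^esub> \<otimes>\<^sub>t \<zero>\<^bsub>W\<^esub>"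
      by (simp add: tens_zero_left tensor_zero)
    then show ?case using tens[of "\<zero>\<^bsub>V\<^esub>" "\<zero>\<^bsub>W\<^esub>"] by (simp)
  next
    case (add c s g)
    obtain v w where s: "s = (v, w)" "v \<in> carrier V" "w \<in> carrier W" using add(2) by auto
    have "cls (c \<odot>\<^bsub>F\<^esub> free_gen K s \<oplus>\<^bsub>F\<^esub> g) = cls (c \<odot>\<^bsub>F\<^esub> free_gen K s) \<oplus>\<^bsub>T\<^esub> cls g"
      using add(1,3) s by (intro tensor_add[symmetric] F.smult_closed) (auto intro: gen_closed)
    also have "cls (c \<odot>\<^bsub>F\<^esub> free_gen K s) = (c \<odot>\<^bsub>V\<^esub> v) \<otimes>\<^sub>t w"
      using add(1) s by (simp add: tens_smult_left) (simp add: tensor_smult gen_closed tens_def)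
    finally have eq: "cls (c \<odot>\<^bsub>F\<^esub> free_gen K s \<oplus>\<^bsub>F\<^esub> g) = (c \<odot>\<^bsub>V\<^esub> v) \<otimes>\<^sub>t w \<oplus>\<^bsub>T\<^esub> cls g" .
    show ?case unfolding eq
      using add(1,3,4) s
      by (intro assms(3) tens) (auto intro: cls_closed)
  qed
qed

lemma lin_map_ext:
  assumes "g \<in> lin_map K T M" "h \<in> lin_map K T M"
    and "\<And>v w. \<lbrakk>v \<in> carrier V; w \<in> carrier W\<rbrakk> \<Longrightarrow> g (v \<otimes>\<^sub>t w) = h (v \<otimes>\<^sub>t w)"
    and "t \<in> carrier T"
  shows "g t = h t"
  using assms(4)
  by (induction rule: tensor_induct) (simp_all add: assms(3) lin_mapD[OF assms(1)] lin_mapD[OF assms(2)])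

section \<open>Universal property of the tensor product\<close>

context
  fixes M :: "('k, 'c, 'q) module_scheme" and \<beta>
  assumes M: "module K M" and \<beta>: "\<beta> \<in> bilin_map K V W M"
begin

interpretation M: module K M by (rule M)

lemma bilin_closed: "\<lbrakk>v \<in> carrier V; w \<in> carrier W\<rbrakk> \<Longrightarrow> \<beta> v w \<in> carrier M"
  using \<beta> by (auto simp: bilin_map_def dest: lin_map_closed)

lemma bilin_Pi: "(\<lambda>p. \<beta> (fst p) (snd p)) \<in> carrier V \<times> carrier W \<rightarrow> carrier M"
  by (auto intro: bilin_closed)

lemma free_lift_bilin_lin: "free_lift K M (\<lambda>p. \<beta> (fst p) (snd p)) \<in> lin_map K F M"
  by (rule M.free_lift_lin[OF bilin_Pi])

lemma free_lift_bilin_gen: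
  "\<lbrakk>v \<in> carrier V; w \<in> carrier W\<rbrakk> \<Longrightarrow>
    free_lift K M (\<lambda>p. \<beta> (fst p) (snd p)) (free_gen K (v, w)) = \<beta> v w"
  using M.free_lift_gen[OF bilin_Pi, of "(v, w)"] by simp

text \<open>The kernel of the linear extension is a submodule that contains every relation by
  bilinearity, hence it contains the smallest such submodule.\<close>

lemma free_lift_bilin_N:
  assumes "x \<in> N"
  shows "free_lift K M (\<lambda>p. \<beta> (fst p) (snd p)) x = \<zero>\<^bsub>M\<^esub>"
proof -
  let ?h = "free_lift K M (\<lambda>p. \<beta> (fst p) (snd p))"
  note h = lin_mapD[OF free_lift_bilin_lin]
  have h0: "?h \<zero>\<^bsub>F\<^esub> = \<zero>\<^bsub>M\<^esub>"
    by (rule lin_map_zero[OF F.module_axioms M free_lift_bilin_lin])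
  have hneg: "?h (\<ominus>\<^bsub>F\<^esub> f) = \<ominus>\<^bsub>M\<^esub> ?h f" if f: "f \<in> carrier F" for f
  proof -
    have "?h (\<ominus>\<^bsub>F\<^esub> f) \<oplus>\<^bsub>M\<^esub> ?h f = ?h (\<ominus>\<^bsub>F\<^esub> f \<oplus>\<^bsub>F\<^esub> f)"
      using f by (intro h(2)[symmetric] F.M.a_inv_closed)
    also have "\<dots> = \<zero>\<^bsub>M\<^esub>" using f h0 by (simp only: F.M.l_neg)
    finally show ?thesis
      using f by (intro M.M.minus_equality[symmetric] h(1) F.M.a_inv_closed)
  qed
  have hminus: "?h (f \<ominus>\<^bsub>F\<^esub> g) = \<zero>\<^bsub>M\<^esub>"
    if "f \<in> carrier F" "g \<in> carrier F" "?h f = ?h g" for f g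
    using that by (simp add: a_minus_def h hneg M.M.r_neg)
  have \<beta>l: "\<beta> (v \<oplus>\<^bsub>V\<^esub> v') w = \<beta> v w \<oplus>\<^bsub>M\<^esub> \<beta> v' w" "\<beta> (c \<odot>\<^bsub>V\<^esub> v) w = c \<odot>\<^bsub>M\<^esub> \<beta> v w"
    if "v \<in> carrier V" "v' \<in> carrier V" "w \<in> carrier W" "c \<in> carrier K" for v v' w c
    using \<beta> that lin_map_add[of "\<lambda>v. \<beta> v w" K V M] lin_map_smult[of "\<lambda>v. \<beta> v w" K V M]
    by (auto simp: bilin_map_def)
  have \<beta>r: "\<beta> v (w \<oplus>\<^bsub>W\<^esub> w') = \<beta> v w \<oplus>\<^bsub>M\<^esub> \<beta> v w'" "\<beta> v (c \<odot>\<^bsub>W\<^esub> w) = c \<odot>\<^bsub>M\<^esub> \<beta> v w"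
    if "v \<in> carrier V" "w \<in> carrier W" "w' \<in> carrier W" "c \<in> carrier K" for v w w' c
    using \<beta> that lin_map_add[of "\<beta> v" K W M] lin_map_smult[of "\<beta> v" K W M]
    by (auto simp: bilin_map_def)
  have "submodule {f \<in> carrier F. ?h f = \<zero>\<^bsub>M\<^esub>} K F"
    by (rule F.submoduleI) (auto simp: h h0 hneg)
  moreover have "bilinear_relations K V W \<subseteq> {f \<in> carrier F. ?h f = \<zero>\<^bsub>M\<^esub>}"
  proof (intro subsetI CollectI conjI)
    fix x assume x: "x \<in> bilinear_relations K V W"
    then show "x \<in> carrier F" using bilinear_relations_closed by blast
    \<comment> \<open>The paired rules share their premises: \<open>K1\<close> supplies the scalar
      for additivity, and the zero vectors supply the second vector for homogeneity.\<close>
    note K1 = V.R.one_closed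
    from x show "?h x = \<zero>\<^bsub>M\<^esub>"
      unfolding bilinear_relations_def Let_def
      by (auto intro!: hminus
          simp: h free_lift_bilin_gen gen_closed \<beta>l[OF _ _ _ K1] \<beta>r[OF _ _ _ K1] \<beta>l(2)[OF _ V.M.zero_closed]
            \<beta>r(2)[OF _ _ W.M.zero_closed])
  qed
  ultimately show ?thesis using assms N_least by blast
qed

text \<open>\<open>SOME\<close> returns an uncontrolled representative; it differs from
  \<open>f\<close> by an element of \<open>N\<close>, where the linear extension vanishes.\<close>

lemma tensor_lift_cls:
  assumes f: "f \<in> carrier F"
  shows "tensor_lift K M \<beta> (cls f) = free_lift K M (\<lambda>p. \<beta> (fst p) (snd p)) f"
proof -
  let ?h = "free_lift K M (\<lambda>p. \<beta> (fst p) (snd p))"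
  note h = lin_mapD[OF free_lift_bilin_lin]
  have "?h x = ?h f" if x: "x \<in> cls f" for x
  proof -
    from x obtain n where n: "n \<in> N" and xn: "x = n \<oplus>\<^bsub>F\<^esub> f"
      by (auto simp: a_r_coset_def')
    have "n \<in> carrier F" using n N.a_subset by blast
    then show ?thesis using f n free_lift_bilin_N unfolding xn by (simp add: h)
  qed
  moreover have "(SOME x. x \<in> cls f) \<in> cls f"
    by (rule someI[of "\<lambda>x. x \<in> cls f", OF N.a_rcos_self[OF f]])
  ultimately show ?thesis
    unfolding tensor_lift_def Let_def free_lift_def by simp
qed

lemma tensor_lift_tens [simp]:
  assumes "v \<in> carrier V" "w \<in> carrier W"
  shows "tensor_lift K M \<beta> (v \<otimes>\<^sub>t w) = \<beta> v w"
  using assms unfolding tens_def by (simp add: tensor_lift_cls gen_closed free_lift_bilin_gen)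

lemma tensor_lift_lin: "tensor_lift K M \<beta> \<in> lin_map K T M"
  by (rule lin_mapI)
    (auto simp: tensor_carrier tensor_add tensor_smult tensor_lift_cls
      lin_mapD[OF free_lift_bilin_lin])

end

end

section \<open>The tensor product of algebras\<close>

lemma tensor_spaceI: "\<lbrakk>module K V; module K W\<rbrakk> \<Longrightarrow> tensor_space K V W"
  by (rule tensor_space.intro)

lemma module_cong:
  fixes V :: "('k, 'a, 'n) module_scheme" and W :: "('k, 'a, 'p) module_scheme"
  assumes "module K V" "carrier W = carrier V" "add W = add V" "ring.zero W = ring.zero V" "smult W = smult V"
  shows "module K W"
proof -
  interpret V: module K V by fact
  show ?thesis
  proof (rule moduleI)
    show "abelian_group W"
      by (rule abelian_groupI)
        (auto simp: assms(2-5) V.M.a_ac V.M.r_neg intro!: bexI[of _ "\<ominus>\<^bsub>V\<^esub> _"])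
  qed (auto simp: assms(2-5) V.is_cring V.smult_l_distr V.smult_r_distr V.smult_assoc1)
qed

text \<open>The construction sees only carrier, addition and scalars, and the resulting equality is
  literal. A tensor over \<open>A\<close> is thus also a tensor over its opposite, without any
  transport map.\<close>

lemma tensor_space_cong:
  fixes V :: "('k, 'a, 'n) module_scheme" and V' :: "('k, 'a, 'n2) module_scheme"
    and W :: "('k, 'b, 'p) module_scheme" and W' :: "('k, 'b, 'p2) module_scheme"
  assumes "carrier V = carrier V'" "add V = add V'" "smult V = smult V'"
    and "carrier W = carrier W'" "add W = add W'" "smult W = smult W'"
  shows tens_cong: "tens K V W = tens K V' W'"
    and tensor_module_cong: "tensor_module K V W = tensor_module K V' W'"
proof -
  have "bilinear_submodule K V W = bilinear_submodule K V' W'"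
    by (simp add: bilinear_submodule_def bilinear_relations_def assms)
  then show "tens K V W = tens K V' W'" "tensor_module K V W = tensor_module K V' W'"
    by (simp_all add: tens_def tensor_module_def assms fun_eq_iff)
qed

lemma lin_map_eqI:
  "\<lbrakk>g \<in> lin_map K V W; module K V; \<And>x. x \<in> carrier V \<Longrightarrow> h x = g x\<rbrakk> \<Longrightarrow> h \<in> lin_map K V W"
  by (auto simp: lin_map_def Pi_iff module.smult_closed module_def abelian_group_def
      abelian_monoid.a_closed)

lemma tensor_map_cong:
  fixes V :: "('k, 'a, 'n) module_scheme" and V' :: "('k, 'a, 'n2) module_scheme"
    and W :: "('k, 'b, 'p) module_scheme" and W' :: "('k, 'b, 'p2) module_scheme"
  assumes "carrier V = carrier V'" "add V = add V'" "smult V = smult V'"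
    and "carrier W = carrier W'" "add W = add W'" "smult W = smult W'"
  shows "tensor_map K V W = tensor_map K V' W'"
  by (simp add: tensor_map_def fun_eq_iff tens_cong[OF assms] tensor_module_cong[OF assms])

section \<open>Functoriality of the tensor product\<close>

locale tensor_space_map = src: tensor_space K V W + tgt: tensor_space K V' W'
  for K :: "('k, 'm) ring_scheme" (structure)
    and V :: "('k, 'a, 'n) module_scheme" and W :: "('k, 'b, 'p) module_scheme"
    and V' :: "('k, 'c, 'q) module_scheme" and W' :: "('k, 'd, 'r) module_scheme" +
  fixes f :: "'a \<Rightarrow> 'c" and g :: "'b \<Rightarrow> 'd"
  assumes f: "f \<in> lin_map K V V'" and g: "g \<in> lin_map K W W'"
begin

lemma bilin: "(\<lambda>v w. tens K V' W' (f v) (g w)) \<in> bilin_map K V W (tensor_module K V' W')"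
  by (auto simp: bilin_map_def lin_mapD[OF f] lin_mapD[OF g] tgt.tens_add_left tgt.tens_add_right
      tgt.tens_smult_left tgt.tens_smult_right intro!: lin_mapI)

lemma map_lin: "tensor_map K V' W' f g \<in> lin_map K (tensor_module K V W) (tensor_module K V' W')"
  unfolding tensor_map_def by (rule src.tensor_lift_lin[OF tgt.module_tensor bilin])

lemma map_tens:
  "\<lbrakk>v \<in> carrier V; w \<in> carrier W\<rbrakk> \<Longrightarrow>
    tensor_map K V' W' f g (tens K V W v w) = tens K V' W' (f v) (g w)"
  unfolding tensor_map_def by (rule src.tensor_lift_tens[OF tgt.module_tensor bilin])

end

lemma tensor_map_lin:
  assumes "module K V" "module K W" "module K V'" "module K W'"
    and "f \<in> lin_map K V V'" "g \<in> lin_map K W W'"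
  shows "tensor_map K V' W' f g \<in> lin_map K (tensor_module K V W) (tensor_module K V' W')"
  using assms
  by (intro tensor_space_map.map_lin tensor_space_map.intro tensor_spaceI tensor_space_map_axioms.intro)

lemma tensor_map_tens:
  assumes "module K V" "module K W" "module K V'" "module K W'"
    and "f \<in> lin_map K V V'" "g \<in> lin_map K W W'"
    and "v \<in> carrier V" "w \<in> carrier W"
  shows "tensor_map K V' W' f g (tens K V W v w) = tens K V' W' (f v) (g w)"
  using assms
  by (intro tensor_space_map.map_tens tensor_space_map.intro tensor_spaceI tensor_space_map_axioms.intro)

text \<open>The composites \<open>h\<close> and \<open>k\<close> are prescribed only on the
  carriers, so any simplified form may be chosen for them, such as \<open>id\<close> where
  automorphisms cancel.\<close>

lemma tensor_map_comp:
  assumes V: "module K V" "module K W" and V': "module K V'" "module K W'"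
    and V'': "module K V''" "module K W''"
    and fg: "f \<in> lin_map K V V'" "g \<in> lin_map K W W'"
    and fg': "f' \<in> lin_map K V' V''" "g' \<in> lin_map K W' W''"
    and h: "\<And>v. v \<in> carrier V \<Longrightarrow> h v = f' (f v)"
    and k: "\<And>w. w \<in> carrier W \<Longrightarrow> k w = g' (g w)"
    and t: "t \<in> carrier (tensor_module K V W)"
  shows "tensor_map K V'' W'' f' g' (tensor_map K V' W' f g t) = tensor_map K V'' W'' h k t"
proof -
  interpret VW: tensor_space K V W using V by (rule tensor_spaceI)
  have hk: "h \<in> lin_map K V V''" "k \<in> lin_map K W W''"
    using h k V by (auto intro: lin_map_eqI[OF lin_map_comp[OF fg(1) fg'(1)]]
        lin_map_eqI[OF lin_map_comp[OF fg(2) fg'(2)]])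
  show ?thesis
  proof (rule VW.lin_map_ext[OF _ _ _ t])
    show "(\<lambda>t. tensor_map K V'' W'' f' g' (tensor_map K V' W' f g t))
        \<in> lin_map K VW.T (tensor_module K V'' W'')"
      by (rule lin_map_comp[OF tensor_map_lin[OF V V' fg] tensor_map_lin[OF V' V'' fg']])
    show "tensor_map K V'' W'' h k \<in> lin_map K VW.T (tensor_module K V'' W'')"
      by (rule tensor_map_lin[OF V V'' hk])
  qed (simp add: tensor_map_tens[OF V V' fg] tensor_map_tens[OF V' V'' fg'] tensor_map_tens[OF V V'' hk]
      h k lin_map_closed[OF fg(1)] lin_map_closed[OF fg(2)])
qed

lemma id_lin: "id \<in> lin_map K V V"
  by (simp add: lin_map_def)

lemma tensor_map_eq_id:
  assumes V: "module K V" "module K W"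
    and h: "\<And>v. v \<in> carrier V \<Longrightarrow> h v = v" and k: "\<And>w. w \<in> carrier W \<Longrightarrow> k w = w"
    and t: "t \<in> carrier (tensor_module K V W)"
  shows "tensor_map K V W h k t = t"
proof -
  interpret VW: tensor_space K V W using V by (rule tensor_spaceI)
  have hk: "h \<in> lin_map K V V" "k \<in> lin_map K W W"
    using h k V by (auto intro: lin_map_eqI[OF id_lin])
  show ?thesis
    by (rule VW.lin_map_ext[OF tensor_map_lin[OF V V hk] _ _ t, of id, simplified])
      (simp_all add: id_lin tensor_map_tens[OF V V hk] h k)
qed

lemma tensor_alg_sel [simp]:
  "carrier (tensor_alg K A B) = carrier (tensor_module K A B)"
  "add (tensor_alg K A B) = add (tensor_module K A B)"
  "ring.zero (tensor_alg K A B) = ring.zero (tensor_module K A B)"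
  "smult (tensor_alg K A B) = smult (tensor_module K A B)"
  "one (tensor_alg K A B) = tens K A B \<one>\<^bsub>A\<^esub> \<one>\<^bsub>B\<^esub>"
  by (simp_all add: tensor_alg_def Let_def)

lemma k_algebraI:
  assumes "field K" "module K A"
    and "\<And>x y. \<lbrakk>x \<in> carrier A; y \<in> carrier A\<rbrakk> \<Longrightarrow> x \<otimes>\<^bsub>A\<^esub> y \<in> carrier A"
    and "\<one>\<^bsub>A\<^esub> \<in> carrier A"
    and "\<And>x y z. \<lbrakk>x \<in> carrier A; y \<in> carrier A; z \<in> carrier A\<rbrakk> \<Longrightarrow>
      x \<otimes>\<^bsub>A\<^esub> y \<otimes>\<^bsub>A\<^esub> z = x \<otimes>\<^bsub>A\<^esub> (y \<otimes>\<^bsub>A\<^esub> z)"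
    and "\<And>x. x \<in> carrier A \<Longrightarrow> \<one>\<^bsub>A\<^esub> \<otimes>\<^bsub>A\<^esub> x = x"
    and "\<And>x. x \<in> carrier A \<Longrightarrow> x \<otimes>\<^bsub>A\<^esub> \<one>\<^bsub>A\<^esub> = x"
    and "\<And>x y z. \<lbrakk>x \<in> carrier A; y \<in> carrier A; z \<in> carrier A\<rbrakk> \<Longrightarrow>
      (x \<oplus>\<^bsub>A\<^esub> y) \<otimes>\<^bsub>A\<^esub> z = x \<otimes>\<^bsub>A\<^esub> z \<oplus>\<^bsub>A\<^esub> y \<otimes>\<^bsub>A\<^esub> z"
    and "\<And>x y z. \<lbrakk>x \<in> carrier A; y \<in> carrier A; z \<in> carrier A\<rbrakk> \<Longrightarrow>
      z \<otimes>\<^bsub>A\<^esub> (x \<oplus>\<^bsub>A\<^esub> y) = z \<otimes>\<^bsub>A\<^esub> x \<oplus>\<^bsub>A\<^esub> z \<otimes>\<^bsub>A\<^esub> y"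
    and "\<And>c x y. \<lbrakk>c \<in> carrier K; x \<in> carrier A; y \<in> carrier A\<rbrakk> \<Longrightarrow>
      (c \<odot>\<^bsub>A\<^esub> x) \<otimes>\<^bsub>A\<^esub> y = c \<odot>\<^bsub>A\<^esub> (x \<otimes>\<^bsub>A\<^esub> y)"
    and "\<And>c x y. \<lbrakk>c \<in> carrier K; x \<in> carrier A; y \<in> carrier A\<rbrakk> \<Longrightarrow>
      x \<otimes>\<^bsub>A\<^esub> (c \<odot>\<^bsub>A\<^esub> y) = c \<odot>\<^bsub>A\<^esub> (x \<otimes>\<^bsub>A\<^esub> y)"
  shows "k_algebra K A"
proof -
  interpret K: field K by fact
  interpret M: module K A by fact
  have "ring A"
    by (intro ringI monoidI M.M.abelian_group_axioms) (simp_all add: assms(3-9))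
  then show ?thesis
    by (intro k_algebra.intro assms(1,2) k_algebra_axioms.intro) (simp_all add: assms(10,11))
qed

locale tensor_algebra = A: k_algebra K A + B: k_algebra K B
  for K :: "('k, 'm) ring_scheme" (structure)
    and A :: "('k, 'a, 'n) module_scheme" and B :: "('k, 'b, 'p) module_scheme"
begin

sublocale tensor_space K A B
  by (intro tensor_spaceI A.module_axioms B.module_axioms)

abbreviation "AB \<equiv> tensor_alg K A B"
abbreviation tensor_AB (infixl "\<otimes>\<^sub>t" 72) where "a \<otimes>\<^sub>t b \<equiv> tens K A B a b"

lemma module_AB: "module K AB"
  by (rule module_cong[OF module_tensor]) simp_all

lemma lin_map_AB: "lin_map K AB M = lin_map K T M" "lin_map K M' AB = lin_map K M' T"
  by (simp_all add: lin_map_def)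

text \<open>Justifies the inner of the two nested lifts that define the product: left multiplication
  by a fixed pure tensor.\<close>

lemma right_mult_bilin:
  assumes "a \<in> carrier A" "b \<in> carrier B"
  shows "(\<lambda>c d. (a \<otimes>\<^bsub>A\<^esub> c) \<otimes>\<^sub>t (b \<otimes>\<^bsub>B\<^esub> d)) \<in> bilin_map K A B T"
  using assms
  by (auto simp: bilin_map_def A.A.r_distr B.A.r_distr A.smult_mult_right B.smult_mult_right
      tens_add_left tens_add_right tens_smult_left tens_smult_right intro!: lin_mapI)

abbreviation "lmul a b \<equiv> tensor_lift K T (\<lambda>c d. (a \<otimes>\<^bsub>A\<^esub> c) \<otimes>\<^sub>t (b \<otimes>\<^bsub>B\<^esub> d))"

lemmas lmul_lin = tensor_lift_lin[OF module_tensor right_mult_bilin]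
lemmas lmul_tens = tensor_lift_tens[OF module_tensor right_mult_bilin]
lemmas lmul_simps = lmul_tens lin_mapD[OF lmul_lin]

text \<open>The outer lift needs bilinearity in (a, b) for every \<open>t\<close>, whereas
  \<open>lmul\<close> is explicit only on pure tensors; induction over \<open>t\<close> bridges the
  gap.\<close>

lemma lmul_distr:
  assumes "t \<in> carrier T"
  shows "\<lbrakk>a \<in> carrier A; a' \<in> carrier A; b \<in> carrier B\<rbrakk> \<Longrightarrow>
      lmul (a \<oplus>\<^bsub>A\<^esub> a') b t = lmul a b t \<oplus>\<^bsub>T\<^esub> lmul a' b t"
    and "\<lbrakk>a \<in> carrier A; b \<in> carrier B; b' \<in> carrier B\<rbrakk> \<Longrightarrow>
      lmul a (b \<oplus>\<^bsub>B\<^esub> b') t = lmul a b t \<oplus>\<^bsub>T\<^esub> lmul a b' t"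
    and "\<lbrakk>c \<in> carrier K; a \<in> carrier A; b \<in> carrier B\<rbrakk> \<Longrightarrow>
      lmul (c \<odot>\<^bsub>A\<^esub> a) b t = c \<odot>\<^bsub>T\<^esub> lmul a b t"
    and "\<lbrakk>c \<in> carrier K; a \<in> carrier A; b \<in> carrier B\<rbrakk> \<Longrightarrow>
      lmul a (c \<odot>\<^bsub>B\<^esub> b) t = c \<odot>\<^bsub>T\<^esub> lmul a b t"
  using assms
  by (induction rule: tensor_induct)
    (auto simp: lmul_simps T.smult_r_distr T.M.a_ac A.A.l_distr B.A.l_distr
      A.smult_mult_left B.smult_mult_left
      tens_add_left tens_add_right tens_smult_left tens_smult_right)

lemma left_mult_bilin:
  assumes "t \<in> carrier T"
  shows "(\<lambda>a b. lmul a b t) \<in> bilin_map K A B T"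
  using assms by (auto simp: bilin_map_def lmul_distr lmul_simps intro!: lin_mapI)

lemma mult_AB: "s \<otimes>\<^bsub>AB\<^esub> t = tensor_lift K T (\<lambda>a b. lmul a b t) s"
  by (simp add: tensor_alg_def Let_def)

lemma mult_AB_left:
  assumes "t \<in> carrier T"
  shows "s \<in> carrier T \<Longrightarrow> s \<otimes>\<^bsub>AB\<^esub> t \<in> carrier T"
    and "\<lbrakk>s \<in> carrier T; s' \<in> carrier T\<rbrakk> \<Longrightarrow>
      (s \<oplus>\<^bsub>T\<^esub> s') \<otimes>\<^bsub>AB\<^esub> t = s \<otimes>\<^bsub>AB\<^esub> t \<oplus>\<^bsub>T\<^esub> s' \<otimes>\<^bsub>AB\<^esub> t"
    and "\<lbrakk>c \<in> carrier K; s \<in> carrier T\<rbrakk> \<Longrightarrow> (c \<odot>\<^bsub>T\<^esub> s) \<otimes>\<^bsub>AB\<^esub> t = c \<odot>\<^bsub>T\<^esub> (s \<otimes>\<^bsub>AB\<^esub> t)"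
  using lin_mapD[OF tensor_lift_lin[OF module_tensor left_mult_bilin[OF assms]]]
  by (simp_all add: mult_AB)

lemma mult_AB_tens:
  "\<lbrakk>a \<in> carrier A; b \<in> carrier B; t \<in> carrier T\<rbrakk> \<Longrightarrow> (a \<otimes>\<^sub>t b) \<otimes>\<^bsub>AB\<^esub> t = lmul a b t"
  by (simp add: mult_AB tensor_lift_tens[OF module_tensor left_mult_bilin])

lemma mult_tens [simp]:
  "\<lbrakk>a \<in> carrier A; b \<in> carrier B; c \<in> carrier A; d \<in> carrier B\<rbrakk> \<Longrightarrow>
    (a \<otimes>\<^sub>t b) \<otimes>\<^bsub>AB\<^esub> (c \<otimes>\<^sub>t d) = (a \<otimes>\<^bsub>A\<^esub> c) \<otimes>\<^sub>t (b \<otimes>\<^bsub>B\<^esub> d)"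
  by (simp add: mult_AB_tens lmul_simps)

lemma mult_AB_right:
  assumes "s \<in> carrier T"
  shows "\<lbrakk>t \<in> carrier T; t' \<in> carrier T\<rbrakk> \<Longrightarrow>
      s \<otimes>\<^bsub>AB\<^esub> (t \<oplus>\<^bsub>T\<^esub> t') = s \<otimes>\<^bsub>AB\<^esub> t \<oplus>\<^bsub>T\<^esub> s \<otimes>\<^bsub>AB\<^esub> t'"
    and "\<lbrakk>c \<in> carrier K; t \<in> carrier T\<rbrakk> \<Longrightarrow> s \<otimes>\<^bsub>AB\<^esub> (c \<odot>\<^bsub>T\<^esub> t) = c \<odot>\<^bsub>T\<^esub> (s \<otimes>\<^bsub>AB\<^esub> t)"
  using assms
  by (induction rule: tensor_induct)
    (auto simp: mult_AB_tens mult_AB_left lmul_simps T.M.a_ac T.smult_r_distr)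

lemma mult_AB_assoc:
  assumes x: "x \<in> carrier T" and y: "y \<in> carrier T" and z: "z \<in> carrier T"
  shows "x \<otimes>\<^bsub>AB\<^esub> y \<otimes>\<^bsub>AB\<^esub> z = x \<otimes>\<^bsub>AB\<^esub> (y \<otimes>\<^bsub>AB\<^esub> z)"
  using x
proof (induction rule: tensor_induct)
  case x: (tens a b)
  from y show ?case
  proof (induction rule: tensor_induct)
    case y: (tens c d)
    from z show ?case
      by (induction rule: tensor_induct) (use x y in \<open>simp_all add: mult_AB_right A.A.m_assoc B.A.m_assoc mult_AB_left\<close>)
  qed (use x z in \<open>simp_all add: mult_AB_right mult_AB_left\<close>)
qed (use y z in \<open>simp_all add: mult_AB_left\<close>)

lemma mult_AB_one:
  assumes "x \<in> carrier T"
  shows "(\<one>\<^bsub>A\<^esub> \<otimes>\<^sub>t \<one>\<^bsub>B\<^esub>) \<otimes>\<^bsub>AB\<^esub> x = x" "x \<otimes>\<^bsub>AB\<^esub> (\<one>\<^bsub>A\<^esub> \<otimes>\<^sub>t \<one>\<^bsub>B\<^esub>) = x"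
  using assms by (induction rule: tensor_induct) (simp_all add: mult_AB_right mult_AB_left)

lemma k_algebra_AB: "k_algebra K AB"
  by (rule k_algebraI)
    (simp_all add: A.K.field_axioms module_AB mult_AB_assoc mult_AB_one mult_AB_right mult_AB_left)

end

lemma tensor_algebraI: "\<lbrakk>k_algebra K A; k_algebra K B\<rbrakk> \<Longrightarrow> tensor_algebra K A B"
  by (rule tensor_algebra.intro)

lemma k_algebra_tensor: "\<lbrakk>k_algebra K A; k_algebra K B\<rbrakk> \<Longrightarrow> k_algebra K (tensor_alg K A B)"
  by (intro tensor_algebra.k_algebra_AB tensor_algebraI)

lemma alg_homD:
  assumes "h \<in> alg_hom K A B"
  shows alg_hom_lin: "h \<in> lin_map K A B"
    and alg_hom_closed: "x \<in> carrier A \<Longrightarrow> h x \<in> carrier B"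
    and alg_hom_mult: "\<lbrakk>x \<in> carrier A; y \<in> carrier A\<rbrakk> \<Longrightarrow> h (x \<otimes>\<^bsub>A\<^esub> y) = h x \<otimes>\<^bsub>B\<^esub> h y"
    and alg_hom_one: "h \<one>\<^bsub>A\<^esub> = \<one>\<^bsub>B\<^esub>"
  using assms by (auto simp: alg_hom_def lin_map_def ring_hom_def)

lemma alg_homI:
  assumes "h \<in> lin_map K A B"
    and "\<And>x y. \<lbrakk>x \<in> carrier A; y \<in> carrier A\<rbrakk> \<Longrightarrow> h (x \<otimes>\<^bsub>A\<^esub> y) = h x \<otimes>\<^bsub>B\<^esub> h y"
    and "h \<one>\<^bsub>A\<^esub> = \<one>\<^bsub>B\<^esub>"
  shows "h \<in> alg_hom K A B"
  using assms by (auto simp: alg_hom_def lin_map_def ring_hom_def)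

lemma tensor_map_alg_hom:
  assumes A: "k_algebra K A" "k_algebra K B" and A': "k_algebra K A'" "k_algebra K B'"
    and f: "f \<in> alg_hom K A A'" and g: "g \<in> alg_hom K B B'"
  shows "tensor_map K A' B' f g \<in> alg_hom K (tensor_alg K A B) (tensor_alg K A' B')"
proof -
  interpret S: tensor_algebra K A B using A by (rule tensor_algebraI)
  interpret T: tensor_algebra K A' B' using A' by (rule tensor_algebraI)
  interpret M: tensor_space_map K A B A' B' f g
    by unfold_locales (use f g in \<open>auto intro: alg_hom_lin\<close>)
  note M = M.map_tens lin_mapD[OF M.map_lin]
  note fg = alg_homD(2-)[OF f] alg_homD(2-)[OF g]
  show ?thesis
  proof (rule alg_homI)
    show "tensor_map K A' B' f g \<in> lin_map K S.AB T.AB"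
      using M.map_lin by (simp add: S.lin_map_AB T.lin_map_AB)
    show "tensor_map K A' B' f g \<one>\<^bsub>S.AB\<^esub> = \<one>\<^bsub>T.AB\<^esub>"
      by (simp add: M fg)
    fix x y assume x: "x \<in> carrier S.AB" and y: "y \<in> carrier S.AB"
    from x have "x \<in> carrier S.T" by simp
    then show "tensor_map K A' B' f g (x \<otimes>\<^bsub>S.AB\<^esub> y) =
      tensor_map K A' B' f g x \<otimes>\<^bsub>T.AB\<^esub> tensor_map K A' B' f g y"
    proof (induction rule: S.tensor_induct)
      case x: (tens a b)
      from y have "y \<in> carrier S.T" by simp
      then show ?case
        by (induction rule: S.tensor_induct)
          (use x in \<open>simp_all add: M fg S.mult_AB_right T.mult_AB_right S.mult_AB_left\<close>)
    next
      case (add x x')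
      then show ?case using y
        by (simp add: M S.mult_AB_left T.mult_AB_left)
    qed
  qed
qed

section \<open>Opposite algebras and the legs of a tensor\<close>

lemma opposite_sel [simp]:
  "carrier (opposite A) = carrier A" "add (opposite A) = add A"
  "ring.zero (opposite A) = ring.zero A" "smult (opposite A) = smult A"
  "one (opposite A) = one A" "x \<otimes>\<^bsub>opposite A\<^esub> y = y \<otimes>\<^bsub>A\<^esub> x" "opposite (opposite A) = A"
  by (simp_all add: opposite_def)

text \<open>The exponent is a Boolean, so passing to the opposite algebra becomes negation and one
  statement covers all blocks.\<close>

definition opp_if :: "bool \<Rightarrow> ('k, 'a, 'n) module_scheme \<Rightarrow> ('k, 'a, 'n) module_scheme"
  where "opp_if x A = (if x then opposite A else A)"

lemma opp_if_simps [simp]: "opp_if True A = opposite A" "opp_if False A = A"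
  by (simp_all add: opp_if_def)

lemma opp_if_sel [simp]:
  "carrier (opp_if x A) = carrier A" "add (opp_if x A) = add A"
  "ring.zero (opp_if x A) = ring.zero A" "smult (opp_if x A) = smult A" "one (opp_if x A) = one A"
  "opposite (opp_if x A) = opp_if (\<not> x) A"
  by (simp_all add: opp_if_def)

lemma mult_opp_if: "a \<otimes>\<^bsub>opp_if x A\<^esub> b = (if x then b \<otimes>\<^bsub>A\<^esub> a else a \<otimes>\<^bsub>A\<^esub> b)"
  by (simp add: opp_if_def)

lemma alg_hom_opposite: "f \<in> alg_hom K (opposite A) (opposite B) \<longleftrightarrow> f \<in> alg_hom K A B"
  by (auto simp: alg_hom_def ring_hom_def)

lemma alg_hom_opp_if: "f \<in> alg_hom K A B \<Longrightarrow> f \<in> alg_hom K (opp_if x A) (opp_if x B)"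
  by (simp add: opp_if_def alg_hom_opposite)

lemma (in k_algebra) k_algebra_opposite: "k_algebra K (opposite A)"
proof (rule k_algebraI)
  show "module K (opposite A)"
    by (rule module_cong[OF module_axioms]) simp_all
qed (simp_all add: K.field_axioms A.m_assoc A.l_distr A.r_distr smult_mult_left smult_mult_right)

lemma (in k_algebra) k_algebra_opp_if: "k_algebra K (opp_if x A)"
  using k_algebra_opposite k_algebra_axioms by (simp add: opp_if_def)

lemma opp_if_tensor [simp]:
  fixes A :: "('k, 'a, 'n) module_scheme" and B :: "('k, 'b, 'p) module_scheme"
  shows "tens K (opp_if x A) (opp_if y B) = tens K A B"
    and "tensor_module K (opp_if x A) (opp_if y B) = tensor_module K A B"
    and "tensor_map K (opp_if x A) (opp_if y B) = tensor_map K A B"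
  by (rule tens_cong tensor_module_cong tensor_map_cong; simp)+

lemma opp_if_tensor3 [simp]:
  fixes A :: "('k, 'a, 'n) module_scheme" and B :: "('k, 'b, 'p) module_scheme"
    and C :: "('k, 'c, 'q) module_scheme"
  shows "tens K (opp_if x A) (tensor_alg K (opp_if y B) (opp_if z C)) = tens K A (tensor_alg K B C)"
    and "tensor_module K (opp_if x A) (tensor_alg K (opp_if y B) (opp_if z C)) =
      tensor_module K A (tensor_alg K B C)"
    and "tensor_map K (opp_if x A) (tensor_alg K (opp_if y B) (opp_if z C)) =
      tensor_map K A (tensor_alg K B C)"
  by (rule tens_cong tensor_module_cong tensor_map_cong; simp)+

abbreviation tensor_opp ::
  "('k, 'm) ring_scheme \<Rightarrow> bool \<Rightarrow> bool \<Rightarrow> ('k, 'a, 'n) module_scheme \<Rightarrow>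
    ('k, ('a \<times> 'a \<Rightarrow> 'k) set) module"
  where "tensor_opp K x y A \<equiv> tensor_alg K (opp_if x A) (opp_if y A)"

abbreviation tensor_opp3 ::
  "('k, 'm) ring_scheme \<Rightarrow> bool \<Rightarrow> bool \<Rightarrow> bool \<Rightarrow> ('k, 'a, 'n) module_scheme \<Rightarrow>
    ('k, ('a \<times> ('a \<times> 'a \<Rightarrow> 'k) set \<Rightarrow> 'k) set) module"
  where "tensor_opp3 K x y z A \<equiv> tensor_alg K (opp_if x A) (tensor_opp K y z A)"

definition tensor_map3 ::
  "('k, 'm) ring_scheme \<Rightarrow> ('k, 'c, 'n) module_scheme \<Rightarrow> ('a \<Rightarrow> 'c) \<Rightarrow> ('a \<Rightarrow> 'c) \<Rightarrow> ('a \<Rightarrow> 'c) \<Rightarrow>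
    ('a \<times> ('a \<times> 'a \<Rightarrow> 'k) set \<Rightarrow> 'k) set \<Rightarrow> ('c \<times> ('c \<times> 'c \<Rightarrow> 'k) set \<Rightarrow> 'k) set"
  where "tensor_map3 K C f g h = tensor_map K C (tensor_alg K C C) f (tensor_map K C C g h)"

context k_algebra
begin

abbreviation "T2 \<equiv> tensor_module K A A"
abbreviation "T3 \<equiv> tensor_module K A (tensor_alg K A A)"

sublocale T2: tensor_algebra K A A
  by (intro tensor_algebraI k_algebra_axioms)

interpretation T3: tensor_algebra K A "tensor_alg K A A"
  by (intro tensor_algebraI k_algebra_axioms T2.k_algebra_AB)

lemma tensor_algebra_opp: "tensor_algebra K (opp_if x A) (opp_if y A)"
  by (intro tensor_algebraI k_algebra_opp_if)

lemma tensor_algebra_opp3: "tensor_algebra K (opp_if x A) (tensor_opp K y z A)"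
  by (intro tensor_algebraI k_algebra_opp_if k_algebra_tensor)

lemma k_algebra_tensor_opp: "k_algebra K (tensor_opp K x y A)"
  by (intro k_algebra_tensor k_algebra_opp_if)

lemma k_algebra_tensor_opp3: "k_algebra K (tensor_opp3 K x y z A)"
  by (intro k_algebra_tensor k_algebra_opp_if)

lemmas tensor_opp_tens = tensor_algebra.mult_tens[OF tensor_algebra_opp, simplified]
lemmas tensor_opp_left = tensor_algebra.mult_AB_left[OF tensor_algebra_opp, simplified]
lemmas tensor_opp_right = tensor_algebra.mult_AB_right[OF tensor_algebra_opp, simplified]
lemmas tensor_opp3_tens = tensor_algebra.mult_tens[OF tensor_algebra_opp3, simplified]
lemmas tensor_opp3_left = tensor_algebra.mult_AB_left[OF tensor_algebra_opp3, simplified]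
lemmas tensor_opp3_right = tensor_algebra.mult_AB_right[OF tensor_algebra_opp3, simplified]

section \<open>Legs in threefold tensor products with exponents\<close>

lemma tens3_closed [simp]:
  "\<lbrakk>a \<in> carrier A; b \<in> carrier A; c \<in> carrier A\<rbrakk> \<Longrightarrow> tens3 K A a b c \<in> carrier T3"
  by (simp add: tens3_def T3.tens_closed)

lemma mult_tens3:
  "\<lbrakk>a \<in> carrier A; b \<in> carrier A; c \<in> carrier A; a' \<in> carrier A; b' \<in> carrier A; c' \<in> carrier A\<rbrakk> \<Longrightarrow>
    tens3 K A a b c \<otimes>\<^bsub>tensor_opp3 K x y z A\<^esub> tens3 K A a' b' c' =
    tens3 K A (a \<otimes>\<^bsub>opp_if x A\<^esub> a') (b \<otimes>\<^bsub>opp_if y A\<^esub> b') (c \<otimes>\<^bsub>opp_if z A\<^esub> c')"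
  by (simp add: tens3_def tensor_opp3_tens tensor_opp_tens)

lemma one_tensor_opp3: "\<one>\<^bsub>tensor_opp3 K x y z A\<^esub> = tens3 K A \<one>\<^bsub>A\<^esub> \<one>\<^bsub>A\<^esub> \<one>\<^bsub>A\<^esub>"
  by (simp add: tens3_def)

lemma leg_bilin:
  "(\<lambda>a b. tens3 K A a b \<one>\<^bsub>A\<^esub>) \<in> bilin_map K A A T3.AB"
  "(\<lambda>a b. tens3 K A a \<one>\<^bsub>A\<^esub> b) \<in> bilin_map K A A T3.AB"
  "(\<lambda>a b. tens3 K A \<one>\<^bsub>A\<^esub> a b) \<in> bilin_map K A A T3.AB"
  by (auto simp: bilin_map_def tens3_def T2.tens_add_left T2.tens_add_right T2.tens_smult_left
      T2.tens_smult_right intro!: lin_mapI T3.tens_closed)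
    (simp_all add: T3.tens_add_left T3.tens_smult_left T3.tens_add_right[simplified]
      T3.tens_smult_right[simplified])

lemma leg_tens:
  assumes "a \<in> carrier A" "b \<in> carrier A"
  shows "leg12 K A (tens K A A a b) = tens3 K A a b \<one>\<^bsub>A\<^esub>"
    and "leg13 K A (tens K A A a b) = tens3 K A a \<one>\<^bsub>A\<^esub> b"
    and "leg23 K A (tens K A A a b) = tens3 K A \<one>\<^bsub>A\<^esub> a b"
  unfolding leg12_def leg13_def leg23_def
  by (rule T2.tensor_lift_tens[OF T3.module_AB] leg_bilin assms)+

lemma leg_lin:
  "leg12 K A \<in> lin_map K T2 T3" "leg13 K A \<in> lin_map K T2 T3" "leg23 K A \<in> lin_map K T2 T3"
  unfolding leg12_def leg13_def leg23_def T3.lin_map_AB[symmetric]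
  by (rule T2.tensor_lift_lin T3.module_AB leg_bilin)+

lemmas legs = lin_mapD[OF leg_lin(1)] lin_mapD[OF leg_lin(2)] lin_mapD[OF leg_lin(3)] leg_tens

abbreviation leg_prod where
  "leg_prod x y z p q r \<equiv> leg12 K A p \<otimes>\<^bsub>tensor_opp3 K x y z A\<^esub> leg13 K A q
    \<otimes>\<^bsub>tensor_opp3 K x y z A\<^esub> leg23 K A r"

text \<open>The opposite of a tensor product is the tensor product of the opposites. In particular,
  complementing both exponents keeps the same pairs of two-sided inverses.\<close>

lemma tensor_opp_flip:
  assumes "s \<in> carrier T2" "t \<in> carrier T2"
  shows "s \<otimes>\<^bsub>tensor_opp K (\<not> x) (\<not> y) A\<^esub> t = t \<otimes>\<^bsub>tensor_opp K x y A\<^esub> s"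
  using assms(1)
proof (induction rule: T2.tensor_induct)
  case s: (tens a b)
  from assms(2) show ?case
    by (induction rule: T2.tensor_induct)
      (use s in \<open>simp_all add: tensor_opp_tens tensor_opp_right tensor_opp_left mult_opp_if\<close>)
qed (use assms(2) in \<open>simp_all add: tensor_opp_left tensor_opp_right\<close>)

text \<open>
  Each of the three tensor slots receives factors from exactly two of the legs, so the order of two
  legs may be reversed by passing to the opposite algebra in the slot they share.
\<close>

lemma leg_prod_flip:
  assumes p: "p \<in> carrier T2" and q: "q \<in> carrier T2" and r: "r \<in> carrier T2"
  shows "leg13 K A q \<otimes>\<^bsub>tensor_opp3 K x y z A\<^esub> leg12 K A p \<otimes>\<^bsub>tensor_opp3 K x y z A\<^esub> leg23 K A r
      = leg_prod (\<not> x) y z p q r" (is "?P1 p q r")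
    and "leg12 K A p \<otimes>\<^bsub>tensor_opp3 K x y z A\<^esub> leg23 K A r \<otimes>\<^bsub>tensor_opp3 K x y z A\<^esub> leg13 K A q
      = leg_prod x y (\<not> z) p q r" (is "?P2 p q r")
    and "leg23 K A r \<otimes>\<^bsub>tensor_opp3 K x y z A\<^esub> leg12 K A p \<otimes>\<^bsub>tensor_opp3 K x y z A\<^esub> leg13 K A q
      = leg_prod x (\<not> y) (\<not> z) p q r" (is "?P3 p q r")
    and "leg13 K A q \<otimes>\<^bsub>tensor_opp3 K x y z A\<^esub> leg23 K A r \<otimes>\<^bsub>tensor_opp3 K x y z A\<^esub> leg12 K A p
      = leg_prod (\<not> x) (\<not> y) z p q r" (is "?P4 p q r")
    and "leg23 K A r \<otimes>\<^bsub>tensor_opp3 K x y z A\<^esub> leg13 K A q \<otimes>\<^bsub>tensor_opp3 K x y z A\<^esub> leg12 K A p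
      = leg_prod (\<not> x) (\<not> y) (\<not> z) p q r" (is "?P5 p q r")
proof -
  have "?P1 p q r \<and> ?P2 p q r \<and> ?P3 p q r \<and> ?P4 p q r \<and> ?P5 p q r"
    using p
  proof (induction rule: T2.tensor_induct)
    case p: (tens a b)
    from q show ?case
    proof (induction rule: T2.tensor_induct)
      case q: (tens c d)
      from r show ?case
        by (induction rule: T2.tensor_induct)
          (use p q in \<open>simp_all add: legs mult_tens3 mult_opp_if tensor_opp3_left tensor_opp3_right\<close>)
    qed (use p r in \<open>simp_all add: legs tensor_opp3_left tensor_opp3_right\<close>)
  qed (use q r in \<open>simp_all add: legs tensor_opp3_left tensor_opp3_right\<close>)
  then show "?P1 p q r" "?P2 p q r" "?P3 p q r" "?P4 p q r" "?P5 p q r" by blast+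
qed

lemma tensor_map_opp_alg_hom:
  assumes "f \<in> alg_hom K A A" "g \<in> alg_hom K A A"
  shows "tensor_map K A A f g \<in> alg_hom K (tensor_opp K x y A) (tensor_opp K x y A)"
  using tensor_map_alg_hom[OF k_algebra_opp_if[of x] k_algebra_opp_if[of y]
      k_algebra_opp_if[of x] k_algebra_opp_if[of y] alg_hom_opp_if[OF assms(1)] alg_hom_opp_if[OF assms(2)]]
  by simp

end

text \<open>Source and target carry independent exponents to cover two uses: the blocks of the
  double, which start from \<open>D\<close> with no exponent, and slotwise endomorphisms, which keep
  all three.\<close>

lemma tensor_map3_alg_hom:
  assumes B: "k_algebra K B" and A: "k_algebra K A"
    and f: "f \<in> alg_hom K (opp_if x' B) (opp_if x A)"
    and g: "g \<in> alg_hom K (opp_if y' B) (opp_if y A)"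
    and h: "h \<in> alg_hom K (opp_if z' B) (opp_if z A)"
  shows "tensor_map3 K A f g h \<in> alg_hom K (tensor_opp3 K x' y' z' B) (tensor_opp3 K x y z A)"
proof -
  note B' = k_algebra.k_algebra_opp_if[OF B] and A' = k_algebra.k_algebra_opp_if[OF A]
  show ?thesis
    using tensor_map_alg_hom[OF B' k_algebra_tensor[OF B' B'] A' k_algebra_tensor[OF A' A'] f
        tensor_map_alg_hom[OF B' B' A' A' g h]]
    by (simp add: tensor_map3_def)
qed

text \<open>A leg inserts 1 in its empty slot, so unital linear maps are the natural generality.
  This matters for the second projection of the double, which reverses products when regarded as a
  map to \<open>A\<close>.\<close>

lemma leg_natural:
  assumes B: "k_algebra K B" and C: "k_algebra K C"
    and f: "f \<in> lin_map K B C" "f \<one>\<^bsub>B\<^esub> = \<one>\<^bsub>C\<^esub>"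
    and g: "g \<in> lin_map K B C" "g \<one>\<^bsub>B\<^esub> = \<one>\<^bsub>C\<^esub>"
    and h: "h \<in> lin_map K B C" "h \<one>\<^bsub>B\<^esub> = \<one>\<^bsub>C\<^esub>"
    and t: "t \<in> carrier (tensor_module K B B)"
  shows "leg12 K C (tensor_map K C C f g t) = tensor_map3 K C f g h (leg12 K B t)"
    and "leg13 K C (tensor_map K C C f h t) = tensor_map3 K C f g h (leg13 K B t)"
    and "leg23 K C (tensor_map K C C g h t) = tensor_map3 K C f g h (leg23 K B t)"
proof -
  interpret B: k_algebra K B by fact
  interpret C: k_algebra K C by fact
  note mB = B.module_axioms and mC = C.module_axioms
  note tl = tensor_map_lin[OF mB mB mC mC] and tt = tensor_map_tens[OF mB mB mC mC]
  have t2: "tensor_map K C C g h \<in> lin_map K B.T2.AB C.T2.AB"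
    using tl[OF g(1) h(1)] by (simp add: lin_map_def)
  have l3: "tensor_map3 K C f g h \<in> lin_map K B.T3 C.T3"
    unfolding tensor_map3_def
    by (rule tensor_map_lin[OF mB B.T2.module_AB mC C.T2.module_AB f(1) t2])
  have t3: "tensor_map3 K C f g h (tens3 K B a b c) = tens3 K C (f a) (g b) (h c)"
    if "a \<in> carrier B" "b \<in> carrier B" "c \<in> carrier B" for a b c
    using that tensor_map_tens[OF mB B.T2.module_AB mC C.T2.module_AB f(1) t2, of a "tens K B B b c"]
    by (simp add: tensor_map3_def tens3_def tt[OF g(1) h(1)])
  note fgh = lin_mapD(1)[OF f(1)] lin_mapD(1)[OF g(1)] lin_mapD(1)[OF h(1)] f(2) g(2) h(2)
  note rules = B.T2.lin_map_ext[OF lin_map_comp lin_map_comp[OF _ l3] _ t]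
  show "leg12 K C (tensor_map K C C f g t) = tensor_map3 K C f g h (leg12 K B t)"
    by (rule rules[OF tl[OF f(1) g(1)] C.leg_lin(1) B.leg_lin(1)])
      (simp add: tt[OF f(1) g(1)] B.leg_tens C.leg_tens t3 fgh)
  show "leg13 K C (tensor_map K C C f h t) = tensor_map3 K C f g h (leg13 K B t)"
    by (rule rules[OF tl[OF f(1) h(1)] C.leg_lin(2) B.leg_lin(2)])
      (simp add: tt[OF f(1) h(1)] B.leg_tens C.leg_tens t3 fgh)
  show "leg23 K C (tensor_map K C C g h t) = tensor_map3 K C f g h (leg23 K B t)"
    by (rule rules[OF tl[OF g(1) h(1)] C.leg_lin(3) B.leg_lin(3)])
      (simp add: tt[OF g(1) h(1)] B.leg_tens C.leg_tens t3 fgh)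
qed

section \<open>The double and its blocks\<close>

lemma module_tensor_alg:
  "\<lbrakk>module K V; module K W\<rbrakk> \<Longrightarrow> module K (tensor_alg K V W)"
  by (rule module_cong[OF tensor_space.module_tensor[OF tensor_spaceI]]) simp_all

lemma lin_map_tensor_alg [simp]:
  "lin_map K (tensor_alg K V W) M = lin_map K (tensor_module K V W) M"
  "lin_map K M (tensor_alg K V W) = lin_map K M (tensor_module K V W)"
  by (simp_all add: lin_map_def)

section \<open>Linear decompositions and tensor products\<close>

lemma (in abelian_monoid) a_interchange:
  "\<lbrakk>a \<in> carrier G; b \<in> carrier G; c \<in> carrier G; d \<in> carrier G\<rbrakk> \<Longrightarrow>
    (a \<oplus> b) \<oplus> (c \<oplus> d) = (a \<oplus> c) \<oplus> (b \<oplus> d)"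
  by (simp add: a_ac)

text \<open>The sections \<open>i\<close> turn joint injectivity of the two maps into an equation
  between linear maps, which is stable under tensoring with a further module. One target serves both
  maps since an algebra and its opposite share their underlying module.\<close>

definition splits ::
  "('k, 'm) ring_scheme \<Rightarrow> ('k, 'a, 'n) module_scheme \<Rightarrow> ('k, 'b, 'p) module_scheme \<Rightarrow>
    (bool \<Rightarrow> 'a \<Rightarrow> 'b) \<Rightarrow> (bool \<Rightarrow> 'b \<Rightarrow> 'a) \<Rightarrow> bool"
  where "splits K V V' f i \<longleftrightarrow> module K V \<and> module K V' \<and>
    (\<forall>x. f x \<in> lin_map K V V' \<and> i x \<in> lin_map K V' V) \<and>
    (\<forall>v \<in> carrier V. i False (f False v) \<oplus>\<^bsub>V\<^esub> i True (f True v) = v)"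

lemma splits_separating:
  assumes "splits K V V' f i" "v \<in> carrier V" "v' \<in> carrier V" "\<And>x. f x v = f x v'"
  shows "v = v'"
  using assms unfolding splits_def by metis

text \<open>On a pure tensor the two composites add up inside the left slot, where the decomposition
  of \<open>V\<close> applies; for a sum, the four terms are regrouped.\<close>

lemma splits_tensor_left:
  assumes s: "splits K V V' f i" and W: "module K W"
  shows "splits K (tensor_alg K V W) (tensor_alg K V' W)
    (\<lambda>x. tensor_map K V' W (f x) id) (\<lambda>x. tensor_map K V W (i x) id)"
proof -
  have V: "module K V" and V': "module K V'" and f: "f x \<in> lin_map K V V'"
    and i: "i x \<in> lin_map K V' V" for x
    using s by (auto simp: splits_def)
  interpret VW: tensor_space K V W using V W by (rule tensor_spaceI)
  note mf = tensor_map_lin[OF V W V' W f id_lin] and mi = tensor_map_lin[OF V' W V W i id_lin]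
  have "tensor_map K V W (i False) id (tensor_map K V' W (f False) id t) \<oplus>\<^bsub>VW.T\<^esub>
      tensor_map K V W (i True) id (tensor_map K V' W (f True) id t) = t" if "t \<in> carrier VW.T" for t
    using that
  proof (induction rule: VW.tensor_induct)
    case (tens v w)
    have 1: "tensor_map K V' W (f x) id (tens K V W v w) = tens K V' W (f x v) w" for x
      using tensor_map_tens[OF V W V' W f id_lin] tens unfolding id_apply by blast
    have 2: "tensor_map K V W (i x) id (tens K V' W v' w) = tens K V W (i x v') w" if "v' \<in> carrier V'" for x v'
      using tensor_map_tens[OF V' W V W i id_lin] tens that unfolding id_apply by blast
    show ?case
      unfolding 1 2[OF lin_map_closed[OF f tens(1)]]
      using tens s lin_map_closed[OF f] lin_map_closed[OF i]
      by (simp add: VW.tens_add_left[symmetric] splits_def)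
  next
    case (add t u)
    have c: "tensor_map K V W (i j) id (tensor_map K V' W (f j) id s) \<in> carrier VW.T" if "s \<in> carrier VW.T" for j s
      using that by (intro lin_mapD(1)[OF mi] lin_mapD(1)[OF mf])
    show ?case
      using add by (simp del: id_apply add: lin_mapD[OF mf] lin_mapD[OF mi]
          VW.T.M.a_interchange[OF c[of t False] c[of u False] c[of t True] c[of u True]])
  qed
  then show ?thesis
    using mf mi V V' W by (simp add: splits_def module_tensor_alg)
qed

lemma splits_tensor_right:
  assumes s: "splits K W W' f i" and V: "module K V"
  shows "splits K (tensor_alg K V W) (tensor_alg K V W')
    (\<lambda>x. tensor_map K V W' id (f x)) (\<lambda>x. tensor_map K V W id (i x))"
proof -
  have W: "module K W" and W': "module K W'" and f: "f x \<in> lin_map K W W'"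
    and i: "i x \<in> lin_map K W' W" for x
    using s by (auto simp: splits_def)
  interpret VW: tensor_space K V W using V W by (rule tensor_spaceI)
  note mf = tensor_map_lin[OF V W V W' id_lin f] and mi = tensor_map_lin[OF V W' V W id_lin i]
  have "tensor_map K V W id (i False) (tensor_map K V W' id (f False) t) \<oplus>\<^bsub>VW.T\<^esub>
      tensor_map K V W id (i True) (tensor_map K V W' id (f True) t) = t" if "t \<in> carrier VW.T" for t
    using that
  proof (induction rule: VW.tensor_induct)
    case (tens v w)
    have 1: "tensor_map K V W' id (f x) (tens K V W v w) = tens K V W' v (f x w)" for x
      using tensor_map_tens[OF V W V W' id_lin f] tens unfolding id_apply by blast
    have 2: "tensor_map K V W id (i x) (tens K V W' v v') = tens K V W v (i x v')" if "v' \<in> carrier W'" for x v'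
      using tensor_map_tens[OF V W' V W id_lin i] tens that unfolding id_apply by blast
    show ?case
      unfolding 1 2[OF lin_map_closed[OF f tens(2)]]
      using tens s lin_map_closed[OF f] lin_map_closed[OF i]
      by (simp add: VW.tens_add_right[symmetric] splits_def)
  next
    case (add t u)
    have c: "tensor_map K V W id (i j) (tensor_map K V W' id (f j) s) \<in> carrier VW.T" if "s \<in> carrier VW.T" for j s
      using that by (intro lin_mapD(1)[OF mi] lin_mapD(1)[OF mf])
    show ?case
      using add by (simp del: id_apply add: lin_mapD[OF mf] lin_mapD[OF mi]
          VW.T.M.a_interchange[OF c[of t False] c[of u False] c[of t True] c[of u True]])
  qed
  then show ?thesis
    using mf mi V W W' by (simp add: splits_def module_tensor_alg)
qed

lemma double_alg_sel [simp]:
  "carrier (double_alg A) = carrier A \<times> carrier A"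
  "p \<oplus>\<^bsub>double_alg A\<^esub> q = (fst p \<oplus>\<^bsub>A\<^esub> fst q, snd p \<oplus>\<^bsub>A\<^esub> snd q)"
  "\<zero>\<^bsub>double_alg A\<^esub> = (\<zero>\<^bsub>A\<^esub>, \<zero>\<^bsub>A\<^esub>)"
  "c \<odot>\<^bsub>double_alg A\<^esub> p = (c \<odot>\<^bsub>A\<^esub> fst p, c \<odot>\<^bsub>A\<^esub> snd p)"
  "\<one>\<^bsub>double_alg A\<^esub> = (\<one>\<^bsub>A\<^esub>, \<one>\<^bsub>A\<^esub>)"
  "p \<otimes>\<^bsub>double_alg A\<^esub> q = (fst p \<otimes>\<^bsub>A\<^esub> fst q, snd q \<otimes>\<^bsub>A\<^esub> snd p)"
  by (simp_all add: double_alg_def alg_prod_def RDirProd_def DirProd_def monoid.defs ring.defs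
      split: prod.split)

definition proj :: "bool \<Rightarrow> 'a \<times> 'a \<Rightarrow> 'a"
  where "proj x = (if x then snd else fst)"

lemma proj_simps [simp]: "proj True p = snd p" "proj False p = fst p"
  by (simp_all add: proj_def)

section \<open>Projections of the double and separation of tensors by blocks\<close>

context k_algebra
begin

abbreviation "D \<equiv> double_alg A"

lemma module_double: "module K D"
proof (rule moduleI)
  show "abelian_group D"
    by (rule abelian_groupI)
      (auto simp: A.a_ac A.r_neg intro!: bexI[of _ "(\<ominus>\<^bsub>A\<^esub> _, \<ominus>\<^bsub>A\<^esub> _)"])
qed (auto simp: is_cring smult_l_distr smult_r_distr smult_assoc1)

lemma k_algebra_double: "k_algebra K D"
  by (rule k_algebraI)
    (auto simp: K.field_axioms module_double A.m_assoc A.l_distr A.r_distr smult_mult_left smult_mult_right)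

text \<open>The second factor of \<open>D\<close> multiplies in reverse, and the exponent on the
  target records this; it is the source of the exponents of all blocks.\<close>

lemma proj_hom: "proj x \<in> alg_hom K D (opp_if x A)"
  by (cases x) (auto simp: alg_hom_def ring_hom_def)

lemma proj_hom_opposite: "proj x \<in> alg_hom K (opposite D) (opp_if (\<not> x) A)"
  using proj_hom[of x] alg_hom_opposite[of "proj x" K D "opp_if x A"] by simp

lemma proj_lin: "proj x \<in> lin_map K D A"
  by (cases x) (auto simp: lin_map_def)

text \<open>Linear sections of the projections. They are not unital in general, and they serve
  injectivity only.\<close>

definition incl :: "bool \<Rightarrow> 'a \<Rightarrow> 'a \<times> 'a"
  where "incl x a = (if x then (\<zero>\<^bsub>A\<^esub>, a) else (a, \<zero>\<^bsub>A\<^esub>))"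

lemma splits_double: "splits K D A proj incl"
  by (auto simp: splits_def module_double module_axioms proj_lin incl_def intro!: lin_mapI)

abbreviation tmap where "tmap \<equiv> tensor_map K A A"

definition block where "block x y = tmap (proj x) (proj y)"
definition block3 where "block3 x y z = tensor_map3 K A (proj x) (proj y) (proj z)"

lemma block_lin: "block x y \<in> lin_map K (tensor_module K D D) T2"
  unfolding block_def
  by (intro tensor_map_lin module_double module_axioms proj_lin)

lemma block_tens:
  "\<lbrakk>d \<in> carrier D; e \<in> carrier D\<rbrakk> \<Longrightarrow>
    block x y (tens K D D d e) = tens K A A (proj x d) (proj y e)"
  unfolding block_def
  by (intro tensor_map_tens module_double module_axioms proj_lin)

lemma block_hom: "block x y \<in> alg_hom K (tensor_alg K D D) (tensor_opp K x y A)"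
  using tensor_map_alg_hom[OF k_algebra_double k_algebra_double k_algebra_opp_if k_algebra_opp_if
      proj_hom[of x] proj_hom[of y]] by (simp add: block_def)

text \<open>Taking the opposite of \<open>D\<close> in the second slot negates the exponent there.
  The orientation axiom of the double lives in D \<otimes> D^op and is read through this
  map.\<close>

lemma block_hom_opposite:
  "block x y \<in> alg_hom K (tensor_alg K D (opposite D)) (tensor_opp K x (\<not> y) A)"
  using tensor_map_alg_hom[OF k_algebra_double k_algebra.k_algebra_opposite[OF k_algebra_double]
      k_algebra_opp_if k_algebra_opp_if proj_hom[of x] proj_hom_opposite[of y]]
  by (simp add: block_def)

lemma block3_hom: "block3 x y z \<in> alg_hom K (tensor_alg3 K D) (tensor_opp3 K x y z A)"
  using tensor_map3_alg_hom[OF k_algebra_double k_algebra_axioms, where x' = False and y' = False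
      and z' = False and x = x and y = y and z = z] proj_hom
  by (simp add: block3_def)

lemma block_separating:
  assumes t: "t \<in> carrier (tensor_module K D D)" and u: "u \<in> carrier (tensor_module K D D)"
    and eq: "\<And>x y. block x y t = block x y u"
  shows "t = u"
proof (rule splits_separating[OF splits_tensor_left[OF splits_double module_double]])
  note mods = module_double module_axioms
  fix x
  show "tensor_map K A D (proj x) id t = tensor_map K A D (proj x) id u"
  proof (rule splits_separating[OF splits_tensor_right[OF splits_double module_axioms]])
    fix y
    have "tmap id (proj y) (tensor_map K A D (proj x) id v) = block x y v"
      if "v \<in> carrier (tensor_module K D D)" for v
      unfolding block_def
      by (rule tensor_map_comp[OF _ _ _ _ _ _ _ _ _ _ _ _ that]) (simp_all add: mods proj_lin id_lin)
    then show "tmap id (proj y) (tensor_map K A D (proj x) id t) =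
        tmap id (proj y) (tensor_map K A D (proj x) id u)"
      using t u eq by simp
  qed (use t u in \<open>auto intro!: lin_map_closed[OF tensor_map_lin] mods proj_lin id_lin\<close>)
qed (use t u in simp_all)

lemma block3_separating:
  assumes t: "t \<in> carrier (tensor_alg3 K D)" and u: "u \<in> carrier (tensor_alg3 K D)"
    and eq: "\<And>x y z. block3 x y z t = block3 x y z u"
  shows "t = u"
proof -
  note mods = module_double module_axioms module_tensor_alg
  \<comment> \<open>The three stages replace \<open>D\<close> by \<open>A\<close> in the middle, the
    last and the first slot; the target of each is the source of the next, and their composite is
    \<open>block3\<close>.\<close>
  note sp1 = splits_tensor_right[OF splits_tensor_left[OF splits_double module_double] module_double]
  note sp2 = splits_tensor_right[OF splits_tensor_right[OF splits_double module_axioms] module_double]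
  note sp3 = splits_tensor_left[OF splits_double T2.module_AB]
  let ?g1 = "\<lambda>y. tensor_map K D (tensor_alg K A D) id (tensor_map K A D (proj y) id)"
  let ?g2 = "\<lambda>z. tensor_map K D (tensor_alg K A A) id (tensor_map K A A id (proj z))"
  let ?g3 = "\<lambda>x. tensor_map K A (tensor_alg K A A) (proj x) id"
  have l1: "tensor_map K A D (proj y) id \<in> lin_map K (tensor_alg K D D) (tensor_alg K A D)"
    and l2: "tmap id (proj z) \<in> lin_map K (tensor_alg K A D) (tensor_alg K A A)" for y z
    by (simp_all add: tensor_map_lin mods proj_lin id_lin)
  have b: "block y z \<in> lin_map K (tensor_alg K D D) (tensor_alg K A A)" for y z
    by (simp add: block_lin)
  have comp: "?g3 x (?g2 z (?g1 y v)) = block3 x y z v" if v: "v \<in> carrier (tensor_alg3 K D)" for x y z v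
  proof -
    have v': "v \<in> carrier (tensor_module K D (tensor_alg K D D))" using v by simp
    have c1: "block y z w = tmap id (proj z) (tensor_map K A D (proj y) id w)"
      if "w \<in> carrier (tensor_alg K D D)" for w
      unfolding block_def
      by (rule tensor_map_comp[symmetric]) (use that in \<open>simp_all add: mods proj_lin id_lin\<close>)
    have "?g2 z (?g1 y v) = tensor_map K D (tensor_alg K A A) id (block y z) v"
      by (rule tensor_map_comp[OF _ _ _ _ _ _ id_lin l1 id_lin l2 _ c1 v']) (simp_all add: mods)
    also have "?g3 x \<dots> = tensor_map K A (tensor_alg K A A) (proj x) (block y z) v"
      by (rule tensor_map_comp[OF _ _ _ _ _ _ id_lin b proj_lin id_lin _ _ v']) (simp_all add: mods)
    finally show ?thesis unfolding block3_def tensor_map3_def block_def .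
  qed
  have c1: "?g1 y v \<in> carrier (tensor_alg K D (tensor_alg K A D))"
    if "v \<in> carrier (tensor_alg3 K D)" for y v
    using lin_map_closed[OF tensor_map_lin[OF module_double _ module_double _ id_lin l1]] that by (simp add: mods)
  have c2: "?g2 z v \<in> carrier (tensor_alg K D (tensor_alg K A A))"
    if "v \<in> carrier (tensor_alg K D (tensor_alg K A D))" for z v
    using lin_map_closed[OF tensor_map_lin[OF module_double _ module_double _ id_lin l2]] that by (simp add: mods)
  show ?thesis
    by (rule splits_separating[OF sp1 t u], rule splits_separating[OF sp2 c1[OF t] c1[OF u]],
        rule splits_separating[OF sp3 c2[OF c1[OF t]] c2[OF c1[OF u]]])
      (simp only: comp[OF t] comp[OF u] eq)
qed

end

section \<open>The blocks of the doubled R-matrix\<close>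

text \<open>Multiply the equation by suitable inverses on the left and on the right until both sides
  cancel down to three factors. These are the forms for blocks in which some legs carry
  \<rho>^-1.\<close>

lemma (in monoid) yang_baxter_inverses:
  assumes c: "a \<in> carrier G" "b \<in> carrier G" "c \<in> carrier G"
      "a' \<in> carrier G" "b' \<in> carrier G" "c' \<in> carrier G"
    and inv: "a \<otimes> a' = \<one>" "a' \<otimes> a = \<one>" "b \<otimes> b' = \<one>" "b' \<otimes> b = \<one>" "c \<otimes> c' = \<one>" "c' \<otimes> c = \<one>"
    and yb: "a \<otimes> b \<otimes> c = c \<otimes> b \<otimes> a"
  shows "b' \<otimes> a' \<otimes> c = c \<otimes> a' \<otimes> b'"
    and "b' \<otimes> c' \<otimes> a = a \<otimes> c' \<otimes> b'"
    and "c' \<otimes> a \<otimes> b = b \<otimes> a \<otimes> c'"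
proof -
  \<comment> \<open>Right-associated words hide adjacent inverse pairs; this form of cancellation
    lets rewriting find them in front of a tail.\<close>
  have cancel: "x \<otimes> (y \<otimes> z) = z" if "x \<otimes> y = \<one>" "x \<in> carrier G" "y \<in> carrier G" "z \<in> carrier G" for x y z
    using that by (metis l_one m_assoc)
  note cancels = cancel[OF inv(1)] cancel[OF inv(2)] cancel[OF inv(3)] cancel[OF inv(4)]
    cancel[OF inv(5)] cancel[OF inv(6)]
  have "b' \<otimes> a' \<otimes> (a \<otimes> b \<otimes> c) \<otimes> (a' \<otimes> b') = c \<otimes> a' \<otimes> b'"
    using c by (simp add: m_assoc cancels)
  moreover have "b' \<otimes> a' \<otimes> (c \<otimes> b \<otimes> a) \<otimes> (a' \<otimes> b') = b' \<otimes> a' \<otimes> c"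
    using c by (simp add: m_assoc cancels inv)
  ultimately show "b' \<otimes> a' \<otimes> c = c \<otimes> a' \<otimes> b'" using yb by simp
  have "b' \<otimes> c' \<otimes> (c \<otimes> b \<otimes> a) \<otimes> (c' \<otimes> b') = a \<otimes> c' \<otimes> b'"
    using c by (simp add: m_assoc cancels)
  moreover have "b' \<otimes> c' \<otimes> (a \<otimes> b \<otimes> c) \<otimes> (c' \<otimes> b') = b' \<otimes> c' \<otimes> a"
    using c by (simp add: m_assoc cancels inv)
  ultimately show "b' \<otimes> c' \<otimes> a = a \<otimes> c' \<otimes> b'" using yb by simp
  have "c' \<otimes> (c \<otimes> b \<otimes> a) \<otimes> c' = b \<otimes> a \<otimes> c'"
    using c by (simp add: m_assoc cancels)
  moreover have "c' \<otimes> (a \<otimes> b \<otimes> c) \<otimes> c' = c' \<otimes> a \<otimes> b"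
    using c by (simp add: m_assoc cancels inv)
  ultimately show "c' \<otimes> a \<otimes> b = b \<otimes> a \<otimes> c'" using yb by simp
qed

lemma alg_isoD:
  assumes "h \<in> alg_iso K A B"
  shows alg_iso_hom: "h \<in> alg_hom K A B" and alg_iso_bij: "bij_betw h (carrier A) (carrier B)"
  using assms by (auto simp: alg_iso_def)

lemma alg_hom_comp:
  "\<lbrakk>f \<in> alg_hom K A B; g \<in> alg_hom K B C\<rbrakk> \<Longrightarrow> g \<circ> f \<in> alg_hom K A C"
  by (auto simp: alg_hom_def ring_hom_def Pi_iff)

lemma id_alg_hom: "id \<in> alg_hom K A A"
  by (auto simp: alg_hom_def ring_hom_def)

lemma (in k_algebra) alg_iso_inv:
  assumes h: "h \<in> alg_iso K A A"
  shows "inv_into (carrier A) h \<in> alg_hom K A A"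
proof -
  note hom = alg_homD[OF alg_iso_hom[OF h]] and bij = alg_iso_bij[OF h]
  let ?i = "inv_into (carrier A) h"
  have i: "?i x \<in> carrier A" "h (?i x) = x" if "x \<in> carrier A" for x
    using that bij by (auto simp: bij_betw_def f_inv_into_f inv_into_into)
  have eq: "?i x = y" if "y \<in> carrier A" "h y = x" for x y
    using that bij by (auto simp: bij_betw_def)
  show ?thesis
    by (rule alg_homI) (auto intro!: lin_mapI eq simp: i hom lin_map_add[OF hom(1)] lin_map_smult[OF hom(1)])
qed

section \<open>Two-sided inverses and their transport by slotwise maps\<close>

context k_algebra
begin

lemma tmap_closed:
  "\<lbrakk>f \<in> alg_hom K A A; g \<in> alg_hom K A A; t \<in> carrier T2\<rbrakk> \<Longrightarrow> tmap f g t \<in> carrier T2"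
  by (rule lin_map_closed[OF tensor_map_lin]) (auto intro: alg_hom_lin module_axioms)

lemma tmap_comp:
  assumes "f \<in> alg_hom K A A" "g \<in> alg_hom K A A" "f' \<in> alg_hom K A A" "g' \<in> alg_hom K A A"
    and "t \<in> carrier T2"
    and "\<And>a. a \<in> carrier A \<Longrightarrow> h a = f' (f a)" "\<And>a. a \<in> carrier A \<Longrightarrow> k a = g' (g a)"
  shows "tmap f' g' (tmap f g t) = tmap h k t"
  using assms by (intro tensor_map_comp) (auto intro: alg_hom_lin module_axioms)

lemma tmap_id: "t \<in> carrier T2 \<Longrightarrow> tmap id id t = t"
  by (rule tensor_map_eq_id) (simp_all add: module_axioms)

text \<open>A relation is used because one and the same tensor has different inverses in the several
  algebras sharing its carrier.\<close>

definition mutual_inverse where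
  "mutual_inverse x y s t \<longleftrightarrow> s \<in> carrier T2 \<and> t \<in> carrier T2 \<and>
    s \<otimes>\<^bsub>tensor_opp K x y A\<^esub> t = tens K A A \<one>\<^bsub>A\<^esub> \<one>\<^bsub>A\<^esub> \<and>
    t \<otimes>\<^bsub>tensor_opp K x y A\<^esub> s = tens K A A \<one>\<^bsub>A\<^esub> \<one>\<^bsub>A\<^esub>"

lemma mutual_inverse_sym: "mutual_inverse x y s t \<Longrightarrow> mutual_inverse x y t s"
  by (auto simp: mutual_inverse_def)

lemma mutual_inverse_flip: "mutual_inverse x y s t \<Longrightarrow> mutual_inverse (\<not> x) (\<not> y) s t"
  by (simp add: mutual_inverse_def tensor_opp_flip)

lemma mutual_inverse_tmap:
  assumes "mutual_inverse x y s t" and fg: "f \<in> alg_hom K A A" "g \<in> alg_hom K A A"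
  shows "mutual_inverse x y (tmap f g s) (tmap f g t)"
proof -
  have s: "s \<in> carrier (tensor_opp K x y A)" and t: "t \<in> carrier (tensor_opp K x y A)"
    using assms(1) by (simp_all add: mutual_inverse_def)
  note h = tensor_map_opp_alg_hom[OF fg, of x y]
  show ?thesis
    using assms(1) alg_hom_mult[OF h s t] alg_hom_mult[OF h t s] alg_hom_one[OF h] fg
    by (simp add: mutual_inverse_def tmap_closed)
qed

lemma mutual_inverse_unique:
  assumes "mutual_inverse x y s t" "mutual_inverse x y s u"
  shows "t = u"
proof -
  interpret AB: k_algebra K "tensor_opp K x y A" by (rule k_algebra_tensor_opp)
  show ?thesis
    using assms AB.A.inv_unique[of t s u] by (simp add: mutual_inverse_def)
qed

text \<open>There is one map per slot, and each leg is twisted by the maps of the two slots it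
  occupies. Identities between twisted legs thus become images of untwisted ones.\<close>

lemma leg_prod_tmap:
  assumes fgh: "f \<in> alg_hom K A A" "g \<in> alg_hom K A A" "h \<in> alg_hom K A A"
    and pqr: "p \<in> carrier T2" "q \<in> carrier T2" "r \<in> carrier T2"
  shows "leg_prod x y z (tmap f g p) (tmap f h q) (tmap g h r) =
    tensor_map3 K A f g h (leg_prod x y z p q r)"
proof -
  have hom: "tensor_map3 K A f g h \<in> alg_hom K (tensor_opp3 K x y z A) (tensor_opp3 K x y z A)"
    by (intro tensor_map3_alg_hom k_algebra_axioms alg_hom_opp_if fgh)
  interpret B: k_algebra K "tensor_opp3 K x y z A" by (rule k_algebra_tensor_opp3)
  note nat = leg_natural[OF k_algebra_axioms k_algebra_axioms
      alg_homD(1,4)[OF fgh(1)] alg_homD(1,4)[OF fgh(2)] alg_homD(1,4)[OF fgh(3)]]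
  have l: "leg12 K A p \<in> carrier (tensor_opp3 K x y z A)"
    "leg13 K A q \<in> carrier (tensor_opp3 K x y z A)"
    "leg23 K A r \<in> carrier (tensor_opp3 K x y z A)"
    using pqr by (simp_all add: legs)
  show ?thesis
    using l pqr by (simp only: nat alg_hom_mult[OF hom] B.A.m_closed)
qed

end

section \<open>Consequences of the orientation axioms\<close>

context oriented_quantum_algebra
begin

abbreviation "\<rho>i \<equiv> inv\<^bsub>tensor_alg K A A\<^esub> \<rho>"
abbreviation "\<tau> \<equiv> td_inv_tu_inv A td tu"

lemma rho_inverse: "mutual_inverse False False \<rho> \<rho>i"
proof -
  interpret B: k_algebra K "tensor_alg K A A" by (intro k_algebra_tensor k_algebra_axioms)
  show ?thesis
    using rho_Units B.A.Units_inv_closed B.A.Units_r_inv B.A.Units_l_inv B.A.Units_closed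
    by (simp add: mutual_inverse_def)
qed

lemma rho_closed [simp]: "\<rho> \<in> carrier T2" "\<rho>i \<in> carrier T2"
  using rho_inverse by (simp_all add: mutual_inverse_def)

lemma td_hom: "td \<in> alg_hom K A A" and tu_hom: "tu \<in> alg_hom K A A"
  using td_auto tu_auto by (auto intro: alg_iso_hom)

lemma tau_hom: "\<tau> \<in> alg_hom K A A"
  unfolding td_inv_tu_inv_def
  by (rule alg_hom_comp[OF alg_iso_inv[OF tu_auto] alg_iso_inv[OF td_auto]])

lemmas td_tu_closed = alg_hom_closed[OF td_hom] alg_hom_closed[OF tu_hom] alg_hom_closed[OF tau_hom]

lemma td_tu_tau: "a \<in> carrier A \<Longrightarrow> td (tu (\<tau> a)) = a"
  using alg_iso_bij[OF td_auto] alg_iso_bij[OF tu_auto] td_tu_commute[of "\<tau> a"] td_tu_closed(3)[of a]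
    alg_hom_closed[OF alg_iso_inv[OF tu_auto], of a]
  by (simp add: td_inv_tu_inv_def bij_betw_inv_into_right)

text \<open>Characterises \<open>\<tau>\<close> as the inverse of td o tu on the carrier, so the
  commutation rules below need no handling of \<open>inv_into\<close>.\<close>

lemma tau_unique:
  assumes "a \<in> carrier A" "b \<in> carrier A" "td (tu b) = a"
  shows "\<tau> a = b"
  using assms(2) alg_iso_bij[OF td_auto] alg_iso_bij[OF tu_auto] td_tu_closed
  by (simp add: assms(3)[symmetric] td_inv_tu_inv_def td_tu_commute bij_betw_inv_into_left)

lemma tu_td_tau: "a \<in> carrier A \<Longrightarrow> tu (td (\<tau> a)) = a"
  using td_tu_tau[of a] td_tu_commute[of "\<tau> a"] td_tu_closed(3)[of a] by simp

lemma tau_td: "a \<in> carrier A \<Longrightarrow> \<tau> (td a) = td (\<tau> a)"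
  by (rule tau_unique) (simp_all add: td_tu_closed td_tu_tau td_tu_commute[symmetric])

lemma tau_tu: "a \<in> carrier A \<Longrightarrow> \<tau> (tu a) = tu (\<tau> a)"
  by (rule tau_unique) (simp_all add: td_tu_closed tu_td_tau td_tu_commute)

lemma tau_td_tu: "a \<in> carrier A \<Longrightarrow> \<tau> (td (tu a)) = a"
  by (rule tau_unique) (simp_all add: td_tu_closed)

lemmas homs = td_hom tu_hom tau_hom id_alg_hom
lemmas comps = td_tu_closed tu_td_tau tau_td tau_tu td_tu_commute

lemmas rho_td = rho_td_td[symmetric] and rho_tu = rho_tu_tu[symmetric]

text \<open>An algebra map that fixes \<rho> sends \<rho>^-1 to an inverse of \<rho>, and inverses
  are unique.\<close>

lemma rhoi_invariant:
  assumes "f \<in> alg_hom K A A" "tmap f f \<rho> = \<rho>"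
  shows "tmap f f \<rho>i = \<rho>i"
  using mutual_inverse_unique[OF mutual_inverse_tmap[OF rho_inverse assms(1) assms(1)]] rho_inverse assms(2)
  by simp

text \<open>Apply \<tau> \<otimes> \<tau> to \<rho> after rewriting \<rho> as its own image under td
  o tu in both slots.\<close>

lemma rho_tau: "tmap \<tau> \<tau> \<rho> = \<rho>"
proof -
  have "tmap \<tau> \<tau> \<rho> = tmap \<tau> \<tau> (tmap td td (tmap tu tu \<rho>))"
    by (simp only: rho_td rho_tu)
  also have "\<dots> = tmap \<tau> \<tau> (tmap (\<lambda>a. td (tu a)) (\<lambda>a. td (tu a)) \<rho>)"
    by (subst tmap_comp) (auto simp: homs)
  also have "\<dots> = tmap id id \<rho>"
    using alg_hom_comp[OF tu_hom td_hom]
    by (intro tmap_comp) (simp_all add: homs comps o_def)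
  also have "\<dots> = \<rho>"
    by (rule tensor_map_eq_id) (simp_all add: module_axioms)
  finally show ?thesis .
qed

lemma rhoi_td: "tmap td td \<rho>i = \<rho>i" and rhoi_tu: "tmap tu tu \<rho>i = \<rho>i"
  and rhoi_tau: "tmap \<tau> \<tau> \<rho>i = \<rho>i"
  by (rule rhoi_invariant; rule homs rho_td rho_tu rho_tau)+

lemma td_rhoi_tu_rho: "mutual_inverse False True (tmap td id \<rho>i) (tmap id tu \<rho>)"
  \<comment> \<open>The instance of \<open>opp_if_tensor\<close> identifies the unit of A \<otimes>
    A^op with that of A \<otimes> A.\<close>
  using inverses by (simp add: mutual_inverse_def tmap_closed homs opp_if_tensor(1)[of K False A True A, simplified])

text \<open>Invariance of \<rho> lets an automorphism cross the tensor sign as its inverse.\<close>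

lemma tmap_td_tu_rho: "tmap id (\<lambda>a. td (tu a)) \<rho> = tmap \<tau> id \<rho>"
proof -
  have "tmap id (\<lambda>a. td (tu a)) \<rho> = tmap id (\<lambda>a. td (tu a)) (tmap \<tau> \<tau> \<rho>)"
    by (simp only: rho_tau)
  also have "\<dots> = tmap \<tau> id \<rho>"
    using alg_hom_comp[OF tu_hom td_hom]
    by (intro tmap_comp) (simp_all add: homs comps o_def)
  finally show ?thesis .
qed

text \<open>This is the orientation axiom under 1 \<otimes> td: its first member becomes (td
  \<otimes> td)(\<rho>^-1), which is \<rho>^-1.\<close>

lemma rhoi_tau_rho: "mutual_inverse False True \<rho>i (tmap \<tau> id \<rho>)"
proof -
  have "tmap id td (tmap td id \<rho>i) = tmap td td \<rho>i"
    by (rule tmap_comp) (simp_all add: homs)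
  moreover have "tmap id td (tmap id tu \<rho>) = tmap id (\<lambda>a. td (tu a)) \<rho>"
    by (rule tmap_comp) (simp_all add: homs)
  ultimately show ?thesis
    using mutual_inverse_tmap[OF td_rhoi_tu_rho homs(4) homs(1)]
    by (simp only: rhoi_td tmap_td_tu_rho)
qed

lemma tau_rhoi_rho: "mutual_inverse False True (tmap id \<tau> \<rho>i) \<rho>"
proof -
  have "tmap id \<tau> (tmap \<tau> id \<rho>) = tmap \<tau> \<tau> \<rho>"
    by (rule tmap_comp) (simp_all add: homs)
  then show ?thesis
    using mutual_inverse_tmap[OF rhoi_tau_rho homs(4) homs(3)] by (simp only: rho_tau)
qed

text \<open>The prospective blocks of the doubled R-matrix, written without reference to the double,
  so that the identities below concern \<open>A\<close> alone.\<close>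

definition rho_block where
  "rho_block x y = (if x = y then \<rho> else if x then \<rho>i else tmap id \<tau> \<rho>i)"

text \<open>Read off from (s \<otimes> 1)(R): \<open>double_s\<close> negates the exponent of the
  first slot and contributes \<open>\<tau>\<close> when the resulting exponent is
  \<open>True\<close>.\<close>

definition inv_block where
  "inv_block x y = (if x = y then \<rho>i else if x then tmap \<tau> id \<rho> else \<rho>)"

lemma block_inverse: "mutual_inverse x y (rho_block x y) (inv_block x y)"
  using rho_inverse mutual_inverse_flip[OF rho_inverse] tau_rhoi_rho
    mutual_inverse_flip[OF rhoi_tau_rho]
  by (cases x; cases y) (simp_all add: rho_block_def inv_block_def)

text \<open>Negating \<open>y\<close> interchanges the roles of the blocks: those with equal
  exponents now lie in A \<otimes> A^op or its opposite, where the orientation axiom applies, and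
  the mixed ones lie in A \<otimes> A or its opposite, where images of the pair \<rho>, \<rho>^-1
  suffice.\<close>

lemma oriented_block_inverse:
  "mutual_inverse x (\<not> y) (tmap td id (inv_block x y)) (tmap id tu (rho_block x y))"
proof -
  \<comment> \<open>Since tu o \<open>\<tau>\<close> inverts td, invariance moves td from the first
    slot to the second in this form.\<close>
  have "tmap td id \<rho>i = tmap id tu (tmap id \<tau> \<rho>i)"
  proof -
    have "tmap td id \<rho>i = tmap td id (tmap tu tu (tmap \<tau> \<tau> \<rho>i))"
      by (simp only: rhoi_tau rhoi_tu)
    also have "\<dots> = tmap td id (tmap (\<lambda>a. tu (\<tau> a)) (\<lambda>a. tu (\<tau> a)) \<rho>i)"
      by (subst tmap_comp) (auto simp: homs)
    also have "\<dots> = tmap id (\<lambda>a. tu (\<tau> a)) \<rho>i"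
      using alg_hom_comp[OF tau_hom tu_hom]
      by (intro tmap_comp) (simp_all add: homs comps o_def)
    also have "\<dots> = tmap id tu (tmap id \<tau> \<rho>i)"
      by (rule tmap_comp[symmetric]) (simp_all add: homs)
    finally show ?thesis .
  qed
  \<comment> \<open>Here td o \<open>\<tau>\<close> inverts tu, and it crosses to the second slot as
    tu.\<close>
  moreover have "tmap td id (tmap \<tau> id \<rho>) = tmap id tu \<rho>"
  proof -
    have "tmap td id (tmap \<tau> id \<rho>) = tmap (\<lambda>a. td (\<tau> a)) id \<rho>"
      by (rule tmap_comp) (simp_all add: homs)
    also have "\<dots> = tmap (\<lambda>a. td (\<tau> a)) id (tmap tu tu \<rho>)"
      by (simp only: rho_tu)
    also have "\<dots> = tmap id tu \<rho>"
      using alg_hom_comp[OF tau_hom td_hom]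
      by (intro tmap_comp) (simp_all add: homs comps o_def)
    finally show ?thesis .
  qed
  ultimately show ?thesis
    using td_rhoi_tu_rho mutual_inverse_flip[OF td_rhoi_tu_rho]
      mutual_inverse_tmap[OF rho_inverse homs(1) homs(4)]
      mutual_inverse_flip[OF mutual_inverse_tmap[OF rho_inverse homs(4) homs(2)]]
    by (cases x; cases y) (simp_all add: rho_block_def inv_block_def)
qed

end

section \<open>The Yang--Baxter equation blockwise\<close>

text \<open>Multiplying the relation for a' by \<open>a\<close> on both sides carries
  \<open>a\<close> from one end of the word to the other, which is a cyclic shift.\<close>

lemma (in monoid) yang_baxter_invert:
  assumes c: "a \<in> carrier G" "a' \<in> carrier G" "b \<in> carrier G" "c \<in> carrier G"
    and inv: "a \<otimes> a' = \<one>" "a' \<otimes> a = \<one>"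
    and yb: "b \<otimes> c \<otimes> a' = a' \<otimes> c \<otimes> b"
  shows "a \<otimes> b \<otimes> c = c \<otimes> b \<otimes> a"
proof -
  have "a \<otimes> b \<otimes> c = a \<otimes> (b \<otimes> c \<otimes> a') \<otimes> a"
    using c by (simp add: m_assoc inv)
  also have "\<dots> = a \<otimes> a' \<otimes> (c \<otimes> b \<otimes> a)"
    using c by (simp only: yb m_assoc m_closed)
  also have "\<dots> = c \<otimes> b \<otimes> a"
    using c by (simp add: inv)
  finally show ?thesis .
qed

context k_algebra
begin

text \<open>The slot that a leg fills with 1 may carry either exponent; only the exponents of its
  two occupied slots must match.\<close>

lemma leg_mult:
  assumes "s \<in> carrier T2" "t \<in> carrier T2"
  shows "leg12 K A (s \<otimes>\<^bsub>tensor_opp K x y A\<^esub> t) =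
      leg12 K A s \<otimes>\<^bsub>tensor_opp3 K x y z A\<^esub> leg12 K A t" (is "?P1 s")
    and "leg13 K A (s \<otimes>\<^bsub>tensor_opp K x z A\<^esub> t) =
      leg13 K A s \<otimes>\<^bsub>tensor_opp3 K x y z A\<^esub> leg13 K A t" (is "?P2 s")
    and "leg23 K A (s \<otimes>\<^bsub>tensor_opp K y z A\<^esub> t) =
      leg23 K A s \<otimes>\<^bsub>tensor_opp3 K x y z A\<^esub> leg23 K A t" (is "?P3 s")
proof -
  have "?P1 s \<and> ?P2 s \<and> ?P3 s"
    using assms(1)
  proof (induction rule: T2.tensor_induct)
    case s: (tens a b)
    from assms(2) show ?case
      by (induction rule: T2.tensor_induct)
        (use s in \<open>simp_all add: legs tensor_opp_tens tensor_opp_right tensor_opp3_right mult_tens3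
          mult_opp_if tensor_opp_left\<close>)
  qed (use assms(2) in \<open>simp_all add: legs tensor_opp_left tensor_opp3_left\<close>)
  then show "?P1 s" "?P2 s" "?P3 s" by blast+
qed

lemma leg_inverse:
  shows "mutual_inverse x y s t \<Longrightarrow>
      leg12 K A s \<otimes>\<^bsub>tensor_opp3 K x y z A\<^esub> leg12 K A t = \<one>\<^bsub>tensor_opp3 K x y z A\<^esub>"
    and "mutual_inverse x z s t \<Longrightarrow>
      leg13 K A s \<otimes>\<^bsub>tensor_opp3 K x y z A\<^esub> leg13 K A t = \<one>\<^bsub>tensor_opp3 K x y z A\<^esub>"
    and "mutual_inverse y z s t \<Longrightarrow>
      leg23 K A s \<otimes>\<^bsub>tensor_opp3 K x y z A\<^esub> leg23 K A t = \<one>\<^bsub>tensor_opp3 K x y z A\<^esub>"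
  unfolding mutual_inverse_def one_tensor_opp3 by (simp_all add: leg_mult[symmetric] leg_tens)

end

context oriented_quantum_algebra
begin

text \<open>In terms of \<open>leg_prod\<close>, two orders of the same legs become one word with
  complementary exponents. The positions of \<rho> and \<rho>^-1 are those of the blocks before
  twisting, except in the third identity, which serves the cyclic blocks after inversion of their
  first leg.\<close>

lemma leg_prod_rho:
  shows "leg_prod True False False \<rho>i \<rho>i \<rho> = leg_prod False True True \<rho>i \<rho>i \<rho>" (is ?t1)
    and "leg_prod True True False \<rho> \<rho>i \<rho>i = leg_prod False False True \<rho> \<rho>i \<rho>i" (is ?t2)
    and "leg_prod False True True \<rho> \<rho> \<rho>i = leg_prod True False False \<rho> \<rho> \<rho>i" (is ?t3)
    and "leg_prod True True True \<rho> \<rho> \<rho> = leg_prod False False False \<rho> \<rho> \<rho>" (is ?t4)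
proof -
  interpret B: k_algebra K "tensor_opp3 K False False False A" by (rule k_algebra_tensor_opp3)
  have closed: "leg12 K A t \<in> carrier (tensor_opp3 K False False False A)"
    "leg13 K A t \<in> carrier (tensor_opp3 K False False False A)"
    "leg23 K A t \<in> carrier (tensor_opp3 K False False False A)" if "t \<in> carrier T2" for t
    using that by (simp_all add: legs)
  note c = closed[OF rho_closed(1)] closed[OF rho_closed(2)]
  note i = leg_inverse[where x = False and y = False and z = False, OF rho_inverse]
    leg_inverse[where x = False and y = False and z = False, OF mutual_inverse_sym[OF rho_inverse]]
  have yb: "leg12 K A \<rho> \<otimes>\<^bsub>tensor_opp3 K False False False A\<^esub> leg13 K A \<rho>
        \<otimes>\<^bsub>tensor_opp3 K False False False A\<^esub> leg23 K A \<rho> =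
      leg23 K A \<rho> \<otimes>\<^bsub>tensor_opp3 K False False False A\<^esub> leg13 K A \<rho>
        \<otimes>\<^bsub>tensor_opp3 K False False False A\<^esub> leg12 K A \<rho>"
    using yang_baxter by (simp add: yang_baxter_def)
  note inverses = B.A.yang_baxter_inverses[OF c(1,2,3,4,5,6) i(1,4,2,5,3,6) yb]
  note flips = leg_prod_flip[where x = False and y = False and z = False]
  show ?t1 using inverses(1) flips(1)[of \<rho>i \<rho>i \<rho>] flips(3)[of \<rho>i \<rho>i \<rho>] by simp
  show ?t2 using inverses(2) flips(4)[of \<rho> \<rho>i \<rho>i] flips(2)[of \<rho> \<rho>i \<rho>i] by simp
  show ?t3 using inverses(3) flips(3)[of \<rho> \<rho> \<rho>i] flips(1)[of \<rho> \<rho> \<rho>i] by simp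
  show ?t4 using yb flips(5)[of \<rho> \<rho> \<rho>] by simp
qed

text \<open>Read in the algebra with exponents \<open>x\<close>, \<open>y\<close>, \<open>z\<close>,
  the hypothesis says that legs 13, 23, 12 may be multiplied in reverse order, with s' on leg 12.
  Multiplication by leg 12 of \<open>s\<close> on both sides yields the relation for
  \<open>s\<close>.\<close>

lemma leg_prod_rho_cyclic:
  assumes "mutual_inverse x y s s'" and q: "q \<in> carrier T2" and r: "r \<in> carrier T2"
    and "leg_prod (\<not> x) (\<not> y) z s' q r = leg_prod x y (\<not> z) s' q r"
  shows "leg_prod x y z s q r = leg_prod (\<not> x) (\<not> y) (\<not> z) s q r"
proof -
  interpret B: k_algebra K "tensor_opp3 K x y z A" by (rule k_algebra_tensor_opp3)
  have s: "s \<in> carrier T2" "s' \<in> carrier T2"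
    using assms(1) by (simp_all add: mutual_inverse_def)
  have closed: "leg12 K A t \<in> carrier (tensor_opp3 K x y z A)"
    "leg13 K A t \<in> carrier (tensor_opp3 K x y z A)"
    "leg23 K A t \<in> carrier (tensor_opp3 K x y z A)" if "t \<in> carrier T2" for t
    using that by (simp_all add: legs)
  have "leg_prod x y z s q r = leg23 K A r \<otimes>\<^bsub>tensor_opp3 K x y z A\<^esub> leg13 K A q
      \<otimes>\<^bsub>tensor_opp3 K x y z A\<^esub> leg12 K A s"
    by (rule B.A.yang_baxter_invert[OF closed(1)[OF s(1)] closed(1)[OF s(2)] closed(2)[OF q] closed(3)[OF r]
          leg_inverse(1)[OF assms(1)] leg_inverse(1)[OF mutual_inverse_sym[OF assms(1)]]])
      (simp only: leg_prod_flip(2,4)[OF s(2) q r] assms(4))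
  then show ?thesis by (simp only: leg_prod_flip(5)[OF s(1) q r])
qed

lemma rho_block_yang_baxter:
  "leg_prod x y z (rho_block x y) (rho_block x z) (rho_block y z) =
    leg_prod (\<not> x) (\<not> y) (\<not> z) (rho_block x y) (rho_block x z) (rho_block y z)"
proof -
  \<comment> \<open>The image of the first identity under 1 \<otimes> \<tau> \<otimes> \<tau>; the
    last leg stays \<rho> by invariance.\<close>
  have FTT: "leg_prod False True True (tmap id \<tau> \<rho>i) (tmap id \<tau> \<rho>i) \<rho> =
      leg_prod True False False (tmap id \<tau> \<rho>i) (tmap id \<tau> \<rho>i) \<rho>"
    using leg_prod_tmap[of id \<tau> \<tau> \<rho>i \<rho>i \<rho>] by (simp only: homs rho_closed rho_tau leg_prod_rho)
  have FFT: "leg_prod False False True \<rho> (tmap id \<tau> \<rho>i) (tmap id \<tau> \<rho>i) =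
      leg_prod True True False \<rho> (tmap id \<tau> \<rho>i) (tmap id \<tau> \<rho>i)"
    using leg_prod_tmap[of id id \<tau> \<rho> \<rho>i \<rho>i] by (simp only: homs rho_closed tmap_id leg_prod_rho)
  \<comment> \<open>The relation for the inverse (\<tau> \<otimes> 1)(\<rho>) of \<rho>^-1 in A^op
    \<otimes> A, as the image of the third identity under \<tau> \<otimes> 1 \<otimes>
    \<tau>.\<close>
  have "leg_prod False True True (tmap \<tau> id \<rho>) \<rho> (tmap id \<tau> \<rho>i) =
      leg_prod True False False (tmap \<tau> id \<rho>) \<rho> (tmap id \<tau> \<rho>i)"
    using leg_prod_tmap[of \<tau> id \<tau> \<rho> \<rho> \<rho>i] by (simp only: homs rho_closed rho_tau leg_prod_rho(3))
  then have TFT: "leg_prod True False True \<rho>i \<rho> (tmap id \<tau> \<rho>i) =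
      leg_prod False True False \<rho>i \<rho> (tmap id \<tau> \<rho>i)"
    using leg_prod_rho_cyclic[of True False \<rho>i "tmap \<tau> id \<rho>" \<rho> "tmap id \<tau> \<rho>i" True]
      mutual_inverse_flip[OF rhoi_tau_rho]
    by (simp add: homs tmap_closed)
  \<comment> \<open>In A \<otimes> A^op the first leg has inverse \<rho>, so the third identity
    applies without a twist.\<close>
  have FTF: "leg_prod False True False (tmap id \<tau> \<rho>i) \<rho> \<rho>i =
      leg_prod True False True (tmap id \<tau> \<rho>i) \<rho> \<rho>i"
    using leg_prod_rho_cyclic[of False True "tmap id \<tau> \<rho>i" \<rho> \<rho> \<rho>i False] tau_rhoi_rho
      leg_prod_rho(3)[symmetric]
    by simp
  show ?thesis
    using leg_prod_rho FTT FFT TFT FTF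
    by (cases x; cases y; cases z) (simp_all add: rho_block_def)
qed

end

section \<open>Chosen expressions for \<rho> and its inverse, and the blocks they produce\<close>

locale double_presentation = oriented_quantum_algebra +
  fixes r n :: nat and a b \<alpha> \<beta>
  assumes a: "a \<in> {1..r} \<rightarrow> carrier A" and b: "b \<in> {1..r} \<rightarrow> carrier A"
    and rho_eq: "\<rho> = (\<Oplus>\<^bsub>tensor_alg K A A\<^esub>i \<in> {1..r}. tens K A A (a i) (b i))"
    and \<alpha>: "\<alpha> \<in> {1..n} \<rightarrow> carrier A" and \<beta>: "\<beta> \<in> {1..n} \<rightarrow> carrier A"
    and rhoi_eq: "\<rho>i = (\<Oplus>\<^bsub>tensor_alg K A A\<^esub>j \<in> {1..n}. tens K A A (\<alpha> j) (\<beta> j))"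
begin

abbreviation "R \<equiv> double_rho K A td tu r a b n \<alpha> \<beta>"
abbreviation "s \<equiv> double_s A td tu"
abbreviation "DD \<equiv> tensor_alg K D D"

text \<open>The chosen expressions enter the argument only here. Afterwards \<open>R\<close> is
  known through its blocks, which depend on \<rho>, \<rho>^-1 and \<tau> alone.\<close>

lemma R_block: "R \<in> carrier (tensor_module K D D)" "block x y R = rho_block x y"
proof -
  interpret DD: module K DD by (intro module_tensor_alg module_double)
  interpret AA: module K "tensor_alg K A A" by (intro module_tensor_alg module_axioms)
  interpret DT: tensor_space K D D by (intro tensor_spaceI module_double)
  have abc: "a i \<in> carrier A" "b i \<in> carrier A" if "i \<in> {1..r}" for i using a b that by auto
  have \<alpha>\<beta>c: "\<alpha> i \<in> carrier A" "\<beta> i \<in> carrier A" if "i \<in> {1..n}" for i using \<alpha> \<beta> that by auto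
  have embc: "emb A c \<in> carrier D" "bar (emb A c) \<in> carrier D" if "c \<in> carrier A" for c
    using that by (simp_all add: emb_def bar_def)
  have proj_emb: "proj x (emb A c) = (if x then \<zero>\<^bsub>A\<^esub> else c)"
    "proj x (bar (emb A c)) = (if x then c else \<zero>\<^bsub>A\<^esub>)" for x c
    by (simp_all add: emb_def bar_def)
  let ?u = "\<lambda>i. tens K D D (emb A (a i)) (emb A (b i)) \<oplus>\<^bsub>DD\<^esub>
          tens K D D (bar (emb A (a i))) (bar (emb A (b i)))"
  let ?v = "\<lambda>j. tens K D D (bar (emb A (\<alpha> j))) (emb A (\<beta> j)) \<oplus>\<^bsub>DD\<^esub>
          tens K D D (emb A (\<alpha> j)) (bar (emb A (\<tau> (\<beta> j))))"
  have R: "R = (\<Oplus>\<^bsub>DD\<^esub>i\<in>{1..r}. ?u i) \<oplus>\<^bsub>DD\<^esub> (\<Oplus>\<^bsub>DD\<^esub>j\<in>{1..n}. ?v j)"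
    by (simp add: double_rho_def Let_def)
  have u: "?u i \<in> carrier DD" if "i \<in> {1..r}" for i
    using that abc by (intro DD.M.a_closed) (simp_all add: DT.tens_closed embc del: double_alg_sel)
  have v: "?v i \<in> carrier DD" if "i \<in> {1..n}" for i
    using that \<alpha>\<beta>c
    by (intro DD.M.a_closed)
      (simp_all add: DT.tens_closed embc td_tu_closed del: double_alg_sel)
  have uv: "?u \<in> {1..r} \<rightarrow> carrier DD" "?v \<in> {1..n} \<rightarrow> carrier DD"
    using u v by blast+
  show "R \<in> carrier (tensor_module K D D)"
    using DD.M.a_closed[OF DD.M.finsum_closed[OF uv(1)] DD.M.finsum_closed[OF uv(2)]]
    unfolding R by simp
  have lin: "block x y \<in> lin_map K DD (tensor_alg K A A)"
    by (simp add: block_lin)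
  \<comment> \<open>An embedded or barred element has zero as its other projection, so each pure
    tensor survives in exactly the block it was built for.\<close>
  have bu: "block x y (?u i) = (if x = y then tens K A A (a i) (b i) else \<zero>\<^bsub>tensor_alg K A A\<^esub>)"
    if "i \<in> {1..r}" for i
    using that abc
    by (subst lin_map_add[OF lin])
      (auto simp: DT.tens_closed embc block_tens proj_emb T2.tens_zero_left T2.tens_zero_right
        simp del: double_alg_sel)
  have bv: "block x y (?v i) = (if x = y then \<zero>\<^bsub>tensor_alg K A A\<^esub> else
      if x then tens K A A (\<alpha> i) (\<beta> i) else tens K A A (\<alpha> i) (\<tau> (\<beta> i)))"
    if "i \<in> {1..n}" for i
    using that \<alpha>\<beta>c
    by (subst lin_map_add[OF lin])
      (auto simp: DT.tens_closed embc block_tens proj_emb T2.tens_zero_left T2.tens_zero_right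
        td_tu_closed simp del: double_alg_sel)
  have sum0: "(\<Oplus>\<^bsub>tensor_alg K A A\<^esub>i\<in>I. \<zero>\<^bsub>T2\<^esub>) = \<zero>\<^bsub>T2\<^esub>" for I :: "nat set"
    using AA.M.finsum_zero[of I] by simp
  have su: "(\<Oplus>\<^bsub>tensor_alg K A A\<^esub>i\<in>{1..r}. block x y (?u i)) =
      (if x = y then \<rho> else \<zero>\<^bsub>tensor_alg K A A\<^esub>)"
    unfolding rho_eq
    using AA.M.finsum_cong'[OF refl, of "\<lambda>i. if x = y then tens K A A (a i) (b i) else \<zero>\<^bsub>tensor_alg K A A\<^esub>" "{1..r}"
        "\<lambda>i. block x y (?u i)"] bu abc
    by (cases "x = y") (auto simp: Pi_iff sum0)
  have \<tau>_rhoi: "tmap id \<tau> \<rho>i = (\<Oplus>\<^bsub>tensor_alg K A A\<^esub>j \<in> {1..n}. tens K A A (\<alpha> j) (\<tau> (\<beta> j)))"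
  proof -
    have lin: "tmap id \<tau> \<in> lin_map K (tensor_alg K A A) (tensor_alg K A A)"
      by (simp add: tensor_map_lin module_axioms alg_hom_lin homs)
    have "tmap id \<tau> (tens K A A (\<alpha> j) (\<beta> j)) = tens K A A (\<alpha> j) (\<tau> (\<beta> j))" if "j \<in> {1..n}" for j
      using that \<alpha>\<beta>c by (subst tensor_map_tens) (simp_all add: module_axioms alg_hom_lin homs)
    then have "(\<Oplus>\<^bsub>tensor_alg K A A\<^esub>j \<in> {1..n}. tmap id \<tau> (tens K A A (\<alpha> j) (\<beta> j))) =
        (\<Oplus>\<^bsub>tensor_alg K A A\<^esub>j \<in> {1..n}. tens K A A (\<alpha> j) (\<tau> (\<beta> j)))"
      using \<alpha>\<beta>c by (intro AA.M.finsum_cong' refl) (auto simp: td_tu_closed)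
    moreover have "(\<lambda>j. tens K A A (\<alpha> j) (\<beta> j)) \<in> {1..n} \<rightarrow> carrier (tensor_alg K A A)"
      using \<alpha>\<beta>c by auto
    ultimately show ?thesis
      unfolding rhoi_eq
      by (simp only: lin_map_finsum[OF AA.module_axioms AA.module_axioms lin])
  qed
  have sv: "(\<Oplus>\<^bsub>tensor_alg K A A\<^esub>i\<in>{1..n}. block x y (?v i)) =
      (if x = y then \<zero>\<^bsub>tensor_alg K A A\<^esub> else if x then \<rho>i else tmap id \<tau> \<rho>i)"
    unfolding \<tau>_rhoi unfolding rhoi_eq
    using AA.M.finsum_cong'[OF refl, of "\<lambda>i. if x = y then \<zero>\<^bsub>tensor_alg K A A\<^esub> else
      if x then tens K A A (\<alpha> i) (\<beta> i) else tens K A A (\<alpha> i) (\<tau> (\<beta> i))" "{1..n}"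
        "\<lambda>i. block x y (?v i)"] bv \<alpha>\<beta>c
    by (cases "x = y"; cases x) (auto simp: Pi_iff sum0 td_tu_closed)
  have "block x y R = (\<Oplus>\<^bsub>tensor_alg K A A\<^esub>i\<in>{1..r}. block x y (?u i)) \<oplus>\<^bsub>tensor_alg K A A\<^esub>
      (\<Oplus>\<^bsub>tensor_alg K A A\<^esub>i\<in>{1..n}. block x y (?v i))"
    unfolding R
    using lin_map_add[OF lin DD.M.finsum_closed[OF uv(1)] DD.M.finsum_closed[OF uv(2)]]
      lin_map_finsum[OF DD.module_axioms AA.module_axioms lin uv(1)]
      lin_map_finsum[OF DD.module_axioms AA.module_axioms lin uv(2)]
    by simp
  also have "\<dots> = rho_block x y"
    unfolding su sv rho_block_def
    by (auto simp: tmap_closed homs)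
  finally show "block x y R = rho_block x y" .
qed

end

section \<open>The double is a quantum algebra\<close>

context k_algebra
begin

text \<open>The exponents before and after may differ because \<open>double_s\<close> exchanges the
  two factors.\<close>

lemma block_tensor_map:
  assumes FG: "F \<in> lin_map K D D" "G \<in> lin_map K D D"
    and fg: "f \<in> alg_hom K A A" "g \<in> alg_hom K A A"
    and t: "t \<in> carrier (tensor_module K D D)"
    and F: "\<And>d. d \<in> carrier D \<Longrightarrow> proj x (F d) = f (proj x' d)"
    and G: "\<And>d. d \<in> carrier D \<Longrightarrow> proj y (G d) = g (proj y' d)"
  shows "block x y (tensor_map K D D F G t) = tmap f g (block x' y' t)"
proof -
  note mods = module_double module_axioms
  have "block x y (tensor_map K D D F G t) = tmap (\<lambda>d. proj x (F d)) (\<lambda>d. proj y (G d)) t"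
    unfolding block_def
    by (rule tensor_map_comp[OF mods(1) mods(1) mods(1) mods(1) mods(2) mods(2) FG proj_lin proj_lin
          refl refl t])
  also have "\<dots> = tmap f g (block x' y' t)"
    unfolding block_def
    by (rule tensor_map_comp[OF mods(1) mods(1) mods(2) mods(2) mods(2) mods(2) proj_lin proj_lin
          alg_hom_lin[OF fg(1)] alg_hom_lin[OF fg(2)] F G t, symmetric])
  finally show ?thesis .
qed

lemma double_t_alg_iso:
  assumes "t \<in> alg_iso K A A"
  shows "double_t t \<in> alg_iso K D D"
proof -
  note h = alg_homD[OF alg_iso_hom[OF assms]]
  have "double_t t \<in> alg_hom K D D"
    by (rule alg_homI)
      (auto simp: double_t_def h lin_map_add[OF h(1)] lin_map_smult[OF h(1)] intro!: lin_mapI)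
  moreover have "double_t t = map_prod t t"
    by (auto simp: double_t_def)
  ultimately show ?thesis
    using bij_betw_map_prod[OF alg_iso_bij[OF assms] alg_iso_bij[OF assms]]
    by (simp add: alg_iso_def)
qed

end

context double_presentation
begin

abbreviation "Ri \<equiv> tensor_map K D D s id R"

lemma tau_bij: "bij_betw \<tau> (carrier A) (carrier A)"
  using bij_betw_trans[OF bij_betw_inv_into[OF alg_iso_bij[OF tu_auto]]
      bij_betw_inv_into[OF alg_iso_bij[OF td_auto]]]
  by (simp add: td_inv_tu_inv_def)

lemma s_alg_iso: "s \<in> alg_iso K D (opposite D)"
proof -
  note h = alg_homD[OF tau_hom]
  have "s \<in> alg_hom K D (opposite D)"
    by (rule alg_homI)
      (auto simp: double_s_def h lin_map_add[OF h(1)] lin_map_smult[OF h(1)] intro!: lin_mapI)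
  moreover have "s = map_prod id \<tau> \<circ> prod.swap"
    by (auto simp: double_s_def)
  moreover have "bij_betw (map_prod id \<tau> \<circ> prod.swap) (carrier A \<times> carrier A) (carrier A \<times> carrier A)"
    by (rule bij_betw_trans[OF _ bij_betw_map_prod[OF bij_betw_id tau_bij]])
      (auto simp: bij_betw_def inj_on_def)
  ultimately show ?thesis by (simp add: alg_iso_def)
qed

lemma s_lin: "s \<in> lin_map K D D"
  using alg_hom_lin[OF alg_iso_hom[OF s_alg_iso]] by (simp add: lin_map_def)

lemma double_t_lin: "double_t td \<in> lin_map K D D" "double_t tu \<in> lin_map K D D"
  by (rule alg_hom_lin[OF alg_iso_hom[OF double_t_alg_iso]], rule td_auto tu_auto)+

lemma tensor_map_closed:
  "\<lbrakk>F \<in> lin_map K D D; G \<in> lin_map K D D; t \<in> carrier (tensor_module K D D)\<rbrakk> \<Longrightarrow>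
    tensor_map K D D F G t \<in> carrier (tensor_module K D D)"
  by (rule lin_map_closed[OF tensor_map_lin]) (simp_all add: module_double)

lemma proj_s: "proj x (s d) = (if x then \<tau> else id) (proj (\<not> x) d)"
  by (cases d) (simp add: double_s_def)

lemma proj_double_t: "proj x (double_t t d) = t (proj x d)"
  by (cases d) (simp add: double_t_def proj_def)

lemma block_Ri: "Ri \<in> carrier (tensor_module K D D)" "block x y Ri = inv_block x y"
proof -
  show "Ri \<in> carrier (tensor_module K D D)"
    by (rule tensor_map_closed[OF s_lin id_lin R_block(1)])
  \<comment> \<open>With both exponents \<open>True\<close>, one \<open>\<tau>\<close> comes from
    \<open>s\<close> and the other from the twisted block of \<open>R\<close>; together they fix
    \<rho>^-1.\<close>
  have "tmap \<tau> id (tmap id \<tau> \<rho>i) = tmap \<tau> \<tau> \<rho>i"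
    by (rule tmap_comp) (simp_all add: homs)
  moreover have "block x y Ri = tmap (if x then \<tau> else id) id (block (\<not> x) y R)"
    by (rule block_tensor_map[OF s_lin id_lin _ _ R_block(1)]) (simp_all add: homs proj_s)
  ultimately show "block x y Ri = inv_block x y"
    by (auto simp: R_block rho_block_def inv_block_def tmap_id rhoi_tau)
qed

lemma R_mult_Ri: "R \<otimes>\<^bsub>DD\<^esub> Ri = \<one>\<^bsub>DD\<^esub>" "Ri \<otimes>\<^bsub>DD\<^esub> R = \<one>\<^bsub>DD\<^esub>"
proof -
  interpret DD: k_algebra K DD by (intro k_algebra_tensor k_algebra_double)
  have c: "R \<in> carrier DD" "Ri \<in> carrier DD"
    using R_block(1) block_Ri(1) by simp_all
  have m: "u \<in> carrier DD \<Longrightarrow> v \<in> carrier DD \<Longrightarrow> u \<otimes>\<^bsub>DD\<^esub> v \<in> carrier (tensor_module K D D)" for u v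
    using DD.A.m_closed by simp
  have o: "\<one>\<^bsub>DD\<^esub> \<in> carrier (tensor_module K D D)"
    using DD.A.one_closed by simp
  note inv = block_inverse[unfolded mutual_inverse_def]
  show "R \<otimes>\<^bsub>DD\<^esub> Ri = \<one>\<^bsub>DD\<^esub>" "Ri \<otimes>\<^bsub>DD\<^esub> R = \<one>\<^bsub>DD\<^esub>"
    using inv
    by (intro block_separating m o c;
        simp only: alg_hom_mult[OF block_hom c(1) c(2)] alg_hom_mult[OF block_hom c(2) c(1)]
          alg_hom_one[OF block_hom] R_block block_Ri; simp)+
qed

lemma R_Units: "R \<in> Units DD" and inv_R: "inv\<^bsub>DD\<^esub> R = Ri"
proof -
  interpret DD: k_algebra K DD by (intro k_algebra_tensor k_algebra_double)
  have c: "R \<in> carrier DD" "Ri \<in> carrier DD"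
    using R_block(1) block_Ri(1) by simp_all
  show "R \<in> Units DD"
    using c R_mult_Ri by (auto simp only: Units_def)
  show "inv\<^bsub>DD\<^esub> R = Ri"
    by (rule DD.A.inv_char[OF c R_mult_Ri])
qed

lemma yang_baxter_R: "yang_baxter K D R"
proof -
  interpret DDD: k_algebra K "tensor_alg3 K D" by (intro k_algebra_tensor k_algebra_double)
  interpret D: k_algebra K D by (rule k_algebra_double)
  have c: "leg12 K D R \<in> carrier (tensor_alg3 K D)" "leg13 K D R \<in> carrier (tensor_alg3 K D)"
    "leg23 K D R \<in> carrier (tensor_alg3 K D)"
    using R_block(1) by (simp_all add: D.legs)
  have one: "proj x \<one>\<^bsub>D\<^esub> = \<one>\<^bsub>A\<^esub>" for x by (simp add: proj_def)
  note nat = leg_natural[OF k_algebra_double k_algebra_axioms proj_lin one proj_lin one proj_lin one R_block(1),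
      folded block_def block3_def, unfolded R_block, symmetric]
  have rb: "rho_block x y \<in> carrier T2" for x y
    using block_inverse[of x y] by (simp add: mutual_inverse_def)
  show ?thesis
    unfolding yang_baxter_def
  proof (rule block3_separating)
    fix x y z
    have "block3 x y z (leg12 K D R \<otimes>\<^bsub>tensor_alg3 K D\<^esub> leg13 K D R \<otimes>\<^bsub>tensor_alg3 K D\<^esub> leg23 K D R) =
        leg_prod x y z (rho_block x y) (rho_block x z) (rho_block y z)"
      using c by (simp only: alg_hom_mult[OF block3_hom] DDD.A.m_closed nat)
    \<comment> \<open>Reversing all three legs negates all three exponents, so in each block the
      equation says that the word is unchanged under complementation.\<close>
    also have "\<dots> = leg23 K A (rho_block y z) \<otimes>\<^bsub>tensor_opp3 K x y z A\<^esub> leg13 K A (rho_block x z)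
        \<otimes>\<^bsub>tensor_opp3 K x y z A\<^esub> leg12 K A (rho_block x y)"
      by (simp only: rho_block_yang_baxter[of x y z] leg_prod_flip(5)[OF rb rb rb])
    also have "\<dots> = block3 x y z (leg23 K D R \<otimes>\<^bsub>tensor_alg3 K D\<^esub> leg13 K D R
        \<otimes>\<^bsub>tensor_alg3 K D\<^esub> leg12 K D R)"
      using c by (simp only: alg_hom_mult[OF block3_hom] DDD.A.m_closed nat)
    finally show "block3 x y z (leg12 K D R \<otimes>\<^bsub>tensor_alg3 K D\<^esub> leg13 K D R
          \<otimes>\<^bsub>tensor_alg3 K D\<^esub> leg23 K D R) =
        block3 x y z (leg23 K D R \<otimes>\<^bsub>tensor_alg3 K D\<^esub> leg13 K D R
          \<otimes>\<^bsub>tensor_alg3 K D\<^esub> leg12 K D R)" .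
  qed (use c in \<open>auto intro!: DDD.A.m_closed simp del: tensor_alg_sel\<close>)
qed

text \<open>Both exponents are complemented: the pure blocks change places, and
  \<open>\<tau>\<close> turns each mixed block into the other, up to the invariance of \<rho> and
  \<rho>^-1 under \<tau> \<otimes> \<tau>.\<close>

lemma R_s_s: "R = tensor_map K D D s s R"
proof (rule block_separating)
  have "tmap \<tau> id (tmap id \<tau> \<rho>i) = tmap \<tau> \<tau> \<rho>i"
    by (rule tmap_comp) (simp_all add: homs)
  moreover have "block x y (tensor_map K D D s s R) =
      tmap (if x then \<tau> else id) (if y then \<tau> else id) (block (\<not> x) (\<not> y) R)" for x y
    by (rule block_tensor_map[OF s_lin s_lin _ _ R_block(1)]) (simp_all add: homs proj_s)
  ultimately show "block x y R = block x y (tensor_map K D D s s R)" for x y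
    by (auto simp: R_block rho_block_def tmap_id rhoi_tau rho_tau)
qed (auto intro: tensor_map_closed s_lin R_block)

text \<open>On every block the doubled map acts as t \<otimes> t, which fixes \<rho> and \<rho>^-1
  and commutes with the twist.\<close>

lemma R_double_t:
  assumes t: "t \<in> alg_iso K A A" and inv: "tmap t t \<rho> = \<rho>"
    and commute: "\<And>a. a \<in> carrier A \<Longrightarrow> \<tau> (t a) = t (\<tau> a)"
  shows "R = tensor_map K D D (double_t t) (double_t t) R"
proof (rule block_separating)
  note th = alg_iso_hom[OF t]
  note tl = alg_hom_lin[OF alg_iso_hom[OF double_t_alg_iso[OF t]]]
  have "tmap t t (tmap id \<tau> \<rho>i) = tmap t (\<lambda>a. t (\<tau> a)) \<rho>i"
    by (rule tmap_comp) (simp_all add: homs th)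
  also have "\<dots> = tmap id \<tau> (tmap t t \<rho>i)"
    by (rule tmap_comp[symmetric]) (simp_all add: homs th commute)
  finally have "tmap t t (tmap id \<tau> \<rho>i) = tmap id \<tau> \<rho>i"
    by (simp only: rhoi_invariant[OF th inv])
  moreover have "block x y (tensor_map K D D (double_t t) (double_t t) R) = tmap t t (block x y R)" for x y
    by (rule block_tensor_map[OF tl tl th th R_block(1)]) (simp_all add: proj_double_t)
  ultimately show "block x y R = block x y (tensor_map K D D (double_t t) (double_t t) R)" for x y
    by (simp add: R_block rho_block_def inv rhoi_invariant[OF th inv])
  show "tensor_map K D D (double_t t) (double_t t) R \<in> carrier (tensor_module K D D)"
    by (rule tensor_map_closed[OF tl tl R_block(1)])
qed (rule R_block)

lemma double_inverses:
  "tensor_map K D D (double_t td) id Ri \<otimes>\<^bsub>tensor_alg K D (opposite D)\<^esub>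
      tensor_map K D D id (double_t tu) R = \<one>\<^bsub>tensor_alg K D (opposite D)\<^esub>" (is "?u \<otimes>\<^bsub>?DO\<^esub> ?v = _")
  "tensor_map K D D id (double_t tu) R \<otimes>\<^bsub>tensor_alg K D (opposite D)\<^esub>
      tensor_map K D D (double_t td) id Ri = \<one>\<^bsub>tensor_alg K D (opposite D)\<^esub>"
proof -
  interpret DO: k_algebra K ?DO
    by (intro k_algebra_tensor k_algebra_double k_algebra.k_algebra_opposite)
  \<comment> \<open>D \<otimes> D^op has the carrier of D \<otimes> D, so separation by blocks
    remains available although the product has changed.\<close>
  have DO: "carrier ?DO = carrier (tensor_module K D D)"
    using opp_if_tensor(2)[of K False D True D] by simp
  have c: "?u \<in> carrier ?DO" "?v \<in> carrier ?DO"
    unfolding DO by (intro tensor_map_closed double_t_lin id_lin R_block block_Ri)+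
  have b: "block x y ?u = tmap td id (inv_block x y)" "block x y ?v = tmap id tu (rho_block x y)" for x y
    unfolding R_block(2)[symmetric] block_Ri(2)[symmetric]
    by (rule block_tensor_map; simp add: double_t_lin id_lin homs R_block(1) block_Ri(1) proj_double_t
        del: double_alg_sel)+
  note inv = oriented_block_inverse[unfolded mutual_inverse_def]
  have m: "u \<in> carrier ?DO \<Longrightarrow> v \<in> carrier ?DO \<Longrightarrow> u \<otimes>\<^bsub>?DO\<^esub> v \<in> carrier (tensor_module K D D)" for u v
    using DO.A.m_closed unfolding DO .
  have o: "\<one>\<^bsub>?DO\<^esub> \<in> carrier (tensor_module K D D)"
    using DO.A.one_closed unfolding DO .
  show "?u \<otimes>\<^bsub>?DO\<^esub> ?v = \<one>\<^bsub>?DO\<^esub>" "?v \<otimes>\<^bsub>?DO\<^esub> ?u = \<one>\<^bsub>?DO\<^esub>"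
    using inv
    by (intro block_separating m o c;
        simp only: alg_hom_mult[OF block_hom_opposite c(1) c(2)] alg_hom_mult[OF block_hom_opposite c(2) c(1)]
          alg_hom_one[OF block_hom_opposite] b; simp)+
qed

section \<open>The quantum structures on the double and the projection to \<open>A\<close>\<close>

lemma quantum_algebra_double: "quantum_algebra K D R s"
  by (intro quantum_algebra.intro quantum_algebra_axioms.intro k_algebra_double R_Units s_alg_iso
      inv_R R_s_s yang_baxter_R)

lemma oriented_quantum_algebra_double:
  "oriented_quantum_algebra K D R (double_t td) (double_t tu)"
proof (intro oriented_quantum_algebra.intro oriented_quantum_algebra_axioms.intro k_algebra_double
    R_Units double_t_alg_iso td_auto tu_auto yang_baxter_R)
  show "R = tensor_map K D D (double_t td) (double_t td) R"
    by (rule R_double_t[OF td_auto rho_td tau_td])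
  show "R = tensor_map K D D (double_t tu) (double_t tu) R"
    by (rule R_double_t[OF tu_auto rho_tu tau_tu])
  show "double_t td (double_t tu x) = double_t tu (double_t td x)" if "x \<in> carrier D" for x
    using that by (auto simp: double_t_def td_tu_commute)
qed (simp_all only: inv_R double_inverses)

text \<open>The compatibility with the R-matrices is the block of \<open>R\<close> with both
  exponents \<open>False\<close>.\<close>

lemma fst_morphism:
  "oriented_quantum_algebra_morphism K D R (double_t td) (double_t tu) A \<rho> td tu fst"
proof (intro oriented_quantum_algebra_morphism.intro oriented_quantum_algebra_double
    oriented_quantum_algebra_axioms oriented_quantum_algebra_morphism_axioms.intro)
  have fst: "proj False = fst" by (simp add: proj_def)
  show "fst \<in> alg_hom K D A"
    using proj_hom[of False] by (simp add: fst)
  show "\<rho> = tensor_map K A A fst fst R"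
    using R_block(2)[of False False] by (simp add: block_def fst rho_block_def)
qed (auto simp: double_t_def)

lemma double_t_s:
  assumes "x \<in> carrier D"
  shows "double_t td (s x) = s (double_t td x)" "double_t tu (s x) = s (double_t tu x)"
  using assms by (auto simp: double_t_def double_s_def tau_td tau_tu)

text \<open>The square of \<open>s\<close> is \<open>\<tau>\<close> in both coordinates, so it
  undoes the doubled td o tu; cancelling one \<open>s\<close> at a time turns this into the
  claim.\<close>

lemma double_t_eq_inv_s:
  assumes "x \<in> carrier D"
  shows "double_t td (double_t tu x) = inv_into (carrier D) s (inv_into (carrier D) s x)"
proof -
  have bij: "bij_betw s (carrier D) (carrier D)"
    using alg_iso_bij[OF s_alg_iso] by simp
  let ?y = "double_t td (double_t tu x)"
  have y: "?y \<in> carrier D" "s ?y \<in> carrier D" "s (s ?y) = x"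
    using assms by (auto simp: double_t_def double_s_def td_tu_closed tau_td_tu)
  show ?thesis
    using bij_betw_inv_into_left[OF bij y(1)] bij_betw_inv_into_left[OF bij y(2)] y(3) by simp
qed

end

theorem theorem1:
  fixes K :: "('k, 'm) ring_scheme" and A :: "('k, 'a, 'p) module_scheme"
    and \<rho> :: "('a \<times> 'a \<Rightarrow> 'k) set" and td tu :: "'a \<Rightarrow> 'a"
    and r n :: nat and a b \<alpha> \<beta> :: "nat \<Rightarrow> 'a"
  assumes "oriented_quantum_algebra K A \<rho> td tu"
    and "a \<in> {1..r} \<rightarrow> carrier A" and "b \<in> {1..r} \<rightarrow> carrier A"
    and "\<rho> = (\<Oplus>\<^bsub>tensor_alg K A A\<^esub>i \<in> {1..r}. tens K A A (a i) (b i))"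
    and "\<alpha> \<in> {1..n} \<rightarrow> carrier A" and "\<beta> \<in> {1..n} \<rightarrow> carrier A"
    and "inv\<^bsub>tensor_alg K A A\<^esub> \<rho> = (\<Oplus>\<^bsub>tensor_alg K A A\<^esub>j \<in> {1..n}. tens K A A (\<alpha> j) (\<beta> j))"
  shows "quantum_algebra K (double_alg A) (double_rho K A td tu r a b n \<alpha> \<beta>) (double_s A td tu)
    \<and> (oriented_quantum_algebra K (double_alg A) (double_rho K A td tu r a b n \<alpha> \<beta>)
          (double_t td) (double_t tu)
       \<and> (\<forall>x \<in> carrier (double_alg A).
            double_t td (double_s A td tu x) = double_s A td tu (double_t td x))
       \<and> (\<forall>x \<in> carrier (double_alg A).
            double_t tu (double_s A td tu x) = double_s A td tu (double_t tu x))
       \<and> (\<forall>x \<in> carrier (double_alg A).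
            double_t td (double_t tu x) =
              inv_into (carrier (double_alg A)) (double_s A td tu)
                (inv_into (carrier (double_alg A)) (double_s A td tu) x)))
    \<and> oriented_quantum_algebra_morphism K
        (double_alg A) (double_rho K A td tu r a b n \<alpha> \<beta>) (double_t td) (double_t tu)
        A \<rho> td tu fst"
proof -
  interpret double_presentation K A \<rho> td tu r n a b \<alpha> \<beta>
    by (intro double_presentation.intro double_presentation_axioms.intro assms)
  show ?thesis
    using quantum_algebra_double oriented_quantum_algebra_double fst_morphism double_t_s
      double_t_eq_inv_s by blast
qed

end
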